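(* Let $m\ge1$ and let $\{F_i^0\}_{i\in\mathbb{Z}}\subset\mathfrak{J}_n$ with $L=\sup_i d_\mu(F_i^0,F_{i+1}^0)<\infty$. Let $F_k$ be the level-$k$ piecewise interpolants of the degree-$m$ set-valued spline subdivision scheme applied to these sets. Then $F_k$ converges uniformly on $\mathbb{R}$ in the metric $d_\mu$ to a set-valued function $F^\infty:\mathbb{R}\to\mathfrak{L}_n$, which satisfies $d_\mu(F^\infty(x),F^\infty(y))\le L|x-y|$ for all $x,y\in\mathbb{R}$.
   Context: Notation: $\mu$ is $n$-dimensional Lebesgue measure; $\operatorname{ci}(E)$ is the closure of the interior of $E$; $\mathfrak{J}_n$ is the family of bounded sets $A\subset\mathbb{R}^n$ with $A=\operatorname{ci}(A)$ and $\mu(\partial A)=0$ (the empty set included); $d_\mu(A,B)=\mu(A\triangle B)$. $\mathfrak{L}_n$ is the complete metric space of Lebesgue measurable subsets of $\mathbb{R}^n$ of finite measure, with metric $d_\mu$ and sets differing by a null set identified; $\mathfrak{J}_n\subset\mathfrak{L}_n$. For nonempty bounded $A$: $d_S(p,A)=d(p,\partial A)$ if $p\in A$, $-d(p,\partial A)$ if $p\notin A$, where $d(q,E)=\min_{e\in E}\|q-e\|$. $O(B,r)=\{p:d(p,B)\le r\}$ for $r\ge0$. Distance average: for nonempty $A,B\in\mathfrak{J}_n$, $x\in\mathbb{R}$, $xA\,\widetilde\oplus\,(1-x)B=\{p: x d_S(p,A)+(1-x)d_S(p,B)\ge0\}$; if $A\ne\emptyset=B$, fix $q\in A$ maximizing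 $d_S(\cdot,A)$ over $A$ and set $xA\,\widetilde\oplus\,(1-x)B=\{p: x d_S(p,A)+(x-1)\|p-q\|\ge0\}$; the distance average of two empty sets is $\emptyset$. Let $h_{A,B}(x)=\mu(xA\,\widetilde\oplus\,(1-x)B)$. $A,B$ satisfy the zero-measure condition if $\mu(\{p: \tfrac12 d_S(p,A)+\tfrac12 d_S(p,B)=0\})=0$. Measure average $tA\oplus(1-t)B$ ($t\in\mathbb{R}$), defined in three steps (a fixed large number $N>0$ and, where needed, a fixed $\varepsilon>0$ are chosen once). Always $tA\oplus(1-t)A=A$. Step 1 (simply different: $B\subsetneq A$, $A\setminus B$ connected). If $A,B$ satisfy the zero-measure condition, or if $t\notin[0,1]$: $tA\oplus(1-t)B=\operatorname{ci}\big(gA\,\widetilde\oplus\,(1-g)B\big)$ where $g\in[-N,N]$ is any point attaining $\inf_{\xi\in[-N,N]}|h_{A,B}(\xi)-(t\mu(A)+(1-t)\mu(B))|$ (the set obtained does not depend on this choice). If the zero-measure condition fails and $t\in[0,1]$: $tA\oplus(1-t)B=\operatorname{ci}(O(B,r)\cap A)$ for any $r\ge0$ with $\mu(O(B,r)\cap A)=t\mu(A)+(1-t)\mu(B)$. Step 2 (nested: $B\subsetneq A$). If $A\setminus B$ has finitely many connected components, for each component $C$ let $R_{C,t}=t(B\cup C)\oplus(1-t)B$ (Step 1), and set $tA\oplus(1-t)B=\bigcup_C R_{C,t}$ for $t\ge0$ and $\operatorname{ci}\big(\bigcap_C R_{C,t}\big)$ for $t<0$. If there are infinitely many components, all components of measure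 $<\varepsilon$ are merged into one set $U$, which is treated as a single component in these formulas. Step 3 (general $A,B$). Let $I=\operatorname{ci}(A\cap B)$, $R_{1,t}=tA\oplus(1-t)I$ and $R_{2,t}=(1-t)B\oplus tI$ (Step 2 averages of nested pairs, weight first on the larger set). Then $tA\oplus(1-t)B=R_{1,t}\cup R_{2,t}$ for $t\in[0,1]$; $=\operatorname{ci}(R_{1,t}\setminus(A\cap B))\cup R_{2,t}$ for $t>1$; and for $t<0$ it is defined as $(1-t)B\oplus tA$, computed by the $t>1$ rule with the roles of $A$ and $B$ exchanged (parameter $1-t>1$). Set-valued spline scheme of degree $m\ge1$: given $\{F_i^k\}_{i\in\mathbb{Z}}\subset\mathfrak{J}_n$, set $F_{2i}^{k+1,0}=F_i^k$, $F_{2i+1}^{k+1,0}=\tfrac12F_i^k\oplus\tfrac12F_{i+1}^k$; for $j=1,\dots,m-1$, $F_i^{k+1,j}=\tfrac12F_i^{k+1,j-1}\oplus\tfrac12F_{i+1}^{k+1,j-1}$; and $F_i^{k+1}=F^{k+1,m-1}_{i-\lfloor(m-1)/2\rfloor}$ ($i\in\mathbb{Z}$, $k=0,1,\dots$). The level-$k$ piecewise interpolant is $F_k(x)=\lambda(x)F_i^k\oplus(1-\lambda(x))F_{i+1}^k$ for $i2^{-k}\le x\le(i+1)2^{-k}$, with $\lambda(x)=(i+1)-x2^k$. *)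

theory Defs
  imports "HOL-Analysis.Analysis"
begin

definition ci :: "'a::topological_space set \<Rightarrow> 'a set" where
  "ci E = closure (interior E)"

definition Jn :: "'a::euclidean_space set set" where
  "Jn = {A. bounded A \<and> A = ci A \<and> frontier A \<in> null_sets lebesgue}"

definition dmu :: "'a::euclidean_space set \<Rightarrow> 'a set \<Rightarrow> real" where
  "dmu A B = measure lebesgue ((A - B) \<union> (B - A))"

definition dS :: "'a::euclidean_space \<Rightarrow> 'a set \<Rightarrow> real" where
  "dS p A = (if p \<in> A then infdist p (frontier A) else - infdist p (frontier A))"

definition Onb :: "'a::euclidean_space set \<Rightarrow> real \<Rightarrow> 'a set" where
  "Onb B r = {p. infdist p B \<le> r}"

definition dcenter :: "'a::euclidean_space set \<Rightarrow> 'a" where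
  "dcenter A = (SOME q. q \<in> A \<and> (\<forall>p\<in>A. dS p A \<le> dS q A))"

definition davg_fun :: "real \<Rightarrow> 'a::euclidean_space set \<Rightarrow> 'a set \<Rightarrow> 'a \<Rightarrow> real" where
  "davg_fun x A B p =
     (if B = {} then x * dS p A + (x - 1) * norm (p - dcenter A)
      else if A = {} then (1 - x) * dS p B + ((1 - x) - 1) * norm (p - dcenter B)
      else x * dS p A + (1 - x) * dS p B)"

definition davg :: "real \<Rightarrow> 'a::euclidean_space set \<Rightarrow> 'a set \<Rightarrow> 'a set" where
  "davg x A B = (if A = {} \<and> B = {} then {} else {p. davg_fun x A B p \<ge> 0})"

definition hAB :: "'a::euclidean_space set \<Rightarrow> 'a set \<Rightarrow> real \<Rightarrow> real" where
  "hAB A B x = measure lebesgue (davg x A B)"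

definition zero_measure_cond :: "'a::euclidean_space set \<Rightarrow> 'a set \<Rightarrow> bool" where
  "zero_measure_cond A B \<longleftrightarrow> {p. davg_fun (1/2) A B p = 0} \<in> null_sets lebesgue"

text \<open>Step 1 (simply different sets).\<close>
definition mavg_step1 :: "real \<Rightarrow> real \<Rightarrow> 'a::euclidean_space set \<Rightarrow> 'a set \<Rightarrow> 'a set" where
  "mavg_step1 N t A B =
     (if A = B then A
      else let \<tau> = t * measure lebesgue A + (1 - t) * measure lebesgue B in
        if zero_measure_cond A B \<or> t \<notin> {0..1} then
          ci (davg (SOME g. g \<in> {-N..N} \<and>
                     \<bar>hAB A B g - \<tau>\<bar> = (INF \<xi>\<in>{-N..N}. \<bar>hAB A B \<xi> - \<tau>\<bar>)) A B)
        else ci (Onb B (SOME r. r \<ge> 0 \<and> measure lebesgue (Onb B r \<inter> A) = \<tau>) \<inter> A))"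

definition step2_comps :: "real \<Rightarrow> 'a::euclidean_space set \<Rightarrow> 'a set \<Rightarrow> 'a set set" where
  "step2_comps \<epsilon> A B =
     (if finite (components (A - B)) then components (A - B)
      else {C \<in> components (A - B). measure lebesgue C \<ge> \<epsilon>} \<union>
           (let U = \<Union>{C \<in> components (A - B). measure lebesgue C < \<epsilon>}
            in if U = {} then {} else {U}))"

text \<open>Step 2 (nested sets, B a proper subset of A).\<close>
definition mavg_step2 :: "real \<Rightarrow> real \<Rightarrow> real \<Rightarrow> 'a::euclidean_space set \<Rightarrow> 'a set \<Rightarrow> 'a set" where
  "mavg_step2 N \<epsilon> t A B =
     (if A = B then A
      else let R = (\<lambda>C. mavg_step1 N t (B \<union> C) B) in
        if t \<ge> 0 then \<Union>(R ` step2_comps \<epsilon> A B)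
        else ci (\<Inter>(R ` step2_comps \<epsilon> A B)))"

definition mavg :: "real \<Rightarrow> real \<Rightarrow> real \<Rightarrow> 'a::euclidean_space set \<Rightarrow> 'a set \<Rightarrow> 'a set" where
  "mavg N \<epsilon> t A B =
     (if A = B then A
      else let I = ci (A \<inter> B) in
        if 0 \<le> t \<and> t \<le> 1 then mavg_step2 N \<epsilon> t A I \<union> mavg_step2 N \<epsilon> (1 - t) B I
        else if t > 1 then ci (mavg_step2 N \<epsilon> t A I - (A \<inter> B)) \<union> mavg_step2 N \<epsilon> (1 - t) B I
        else ci (mavg_step2 N \<epsilon> (1 - t) B I - (A \<inter> B)) \<union> mavg_step2 N \<epsilon> t A I)"

definition spline_refine :: "real \<Rightarrow> real \<Rightarrow> nat \<Rightarrow> (int \<Rightarrow> 'a::euclidean_space set) \<Rightarrow> (int \<Rightarrow> 'a set)" where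
  "spline_refine N \<epsilon> m F =
     (let G0 = (\<lambda>i. if even i then F (i div 2)
                    else mavg N \<epsilon> (1/2) (F (i div 2)) (F (i div 2 + 1)));
          Gm = ((\<lambda>G i. mavg N \<epsilon> (1/2) (G i) (G (i + 1))) ^^ (m - 1)) G0
      in (\<lambda>i. Gm (i - int ((m - 1) div 2))))"

definition spline_level :: "real \<Rightarrow> real \<Rightarrow> nat \<Rightarrow> (int \<Rightarrow> 'a::euclidean_space set) \<Rightarrow> nat \<Rightarrow> int \<Rightarrow> 'a set" where
  "spline_level N \<epsilon> m F0 k = (spline_refine N \<epsilon> m ^^ k) F0"

definition spline_interp :: "real \<Rightarrow> real \<Rightarrow> nat \<Rightarrow> (int \<Rightarrow> 'a::euclidean_space set) \<Rightarrow> nat \<Rightarrow> real \<Rightarrow> 'a set" where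
  "spline_interp N \<epsilon> m F0 k x =
     (let i = \<lfloor>x * 2 ^ k\<rfloor>; lam = real_of_int (i + 1) - x * 2 ^ k
      in mavg N \<epsilon> lam (spline_level N \<epsilon> m F0 k i) (spline_level N \<epsilon> m F0 k (i + 1)))"

end

(* The averages only matter up to null sets. For nested B \<subseteq> A the sets
   {x dS(.,A) + (1-x) dS(.,B) \<ge> 0} increase with x from B to A, and for x \<noteq> 1/2 their boundary level
   sets are null: walking straight towards the frontier realising the smaller weighted distance
   leaves the level set at a linear rate, so the level set is porous, and porous sets are null by
   Vitali covering. The same argument handles the levels of the distance to B, and the level x = 1/2
   when B is empty. Hence the measure of these sets attains every intermediate value, and
   tA + (1-t)B lies between A and B with d(A, M) = (1-t) d(A,B) and d(M, B) = t d(A,B).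
   Each refinement therefore halves the distance of neighbours, smoothing steps never increase it, and
   consecutive interpolants differ by O(2^-k). Completeness is not needed as a general theorem: the
   limit at x is the limsup of the sets F_k(x), which differs from F_k(x) only on the
   union over j \<ge> k of the symmetric differences of F_j(x) and F_{j+1}(x). *)
theory Submission
  imports Defs "HOL-Probability.Distribution_Functions"
begin

section \<open>Porous sets and attained measures\<close>

text \<open>Porosity is used because distances to arbitrary null frontiers need not be
  differentiable, while a hole near a point takes only one step towards one nearest frontier point.
  The weight 1/2 is a genuine exception: where a common frontier point of A and B (say a reentrant
  corner of A) is nearest for both, the two distances coincide and the level can contain an open
  set. The measure of the superlevel sets then jumps at 1/2, and Step 1 falls back on the
  neighbourhoods \<open>Onb B r\<close>. Step 2 applies Step 1 to sets \<open>B \<union> C\<close>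
  that are not shown to lie in \<open>Jn\<close>. Hence the statements about Step 1 ask of the
  larger set only boundedness, a null frontier and an interior point, and their conclusions place
  the average between B and A only up to null sets. The Lipschitz constant stays exactly L although
  interpolants are compared only through grid sets: the resulting error is a multiple of
  \<open>(1/2) ^ k\<close> and vanishes in the limit.\<close>

lemma porous_imp_negligible:
  fixes E :: "'a::euclidean_space set"
  assumes E: "E \<in> lmeasurable" and "\<kappa> > 0"
    and por: "\<And>p r. p \<in> E \<Longrightarrow> r > 0 \<Longrightarrow>
      \<exists>s y. 0 < s \<and> s < r \<and> ball y (\<kappa> * s) \<subseteq> ball p s \<and> ball y (\<kappa> * s) \<inter> E = {}"
  shows "negligible E"
proof (rule ccontr)
  assume "\<not> negligible E"
  then have mpos: "measure lebesgue E > 0"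
    using E by (simp add: negligible_iff_measure measure_nonneg zero_less_measure_iff)
  \<comment> \<open>\<open>c\<close> is the share of a ball's volume that its hole occupies. The
    Vitali balls have at least the measure of \<open>E\<close>, and their holes miss
    \<open>E\<close> but take up at least c times that measure inside \<open>U\<close>; so
    \<open>U\<close> may not exceed \<open>E\<close> by less than this.\<close>
  define c where "c = \<kappa> ^ DIM('a)"
  have c: "c > 0" unfolding c_def using \<open>\<kappa> > 0\<close> by simp
  obtain U where U: "open U" "E \<subseteq> U" "U \<in> lmeasurable" "measure lebesgue U < measure lebesgue E + c * measure lebesgue E"
  proof -
    obtain T where T: "open T" "E \<subseteq> T" "T - E \<in> lmeasurable" "emeasure lebesgue (T - E) < ennreal (c * measure lebesgue E)"
      using sets_lebesgue_outer_open[of E "c * measure lebesgue E"] E mpos c by (auto simp: fmeasurableD)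
    have "T = (T - E) \<union> E" using T by auto
    then have "T \<in> lmeasurable" using T E by (metis fmeasurable.Un)
    moreover have "measure lebesgue (T - E) < c * measure lebesgue E"
      using T mpos c by (simp add: emeasure_eq_measure2 ennreal_less_iff)
    ultimately show thesis
      using that[of T] T E by (simp add: measurable_measure_Diff fmeasurableD)
  qed
  let ?P = "\<lambda>p s y. p \<in> E \<and> 0 < s \<and> ball p s \<subseteq> U \<and> ball y (\<kappa> * s) \<subseteq> ball p s \<and> ball y (\<kappa> * s) \<inter> E = {}"
  let ?K = "{(p, s). \<exists>y. ?P p s y}"
  obtain C where C: "countable C" "C \<subseteq> ?K"
      and pw: "pairwise (\<lambda>i j. disjnt (ball (fst i) (snd i)) (ball (fst j) (snd j))) C"
      and neg: "negligible (E - (\<Union>i\<in>C. ball (fst i) (snd i)))"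
  proof (rule Vitali_covering_theorem_balls[of E ?K fst snd])
    fix x and d :: real assume x: "x \<in> E" "0 < d"
    obtain k where k: "k > 0" "ball x k \<subseteq> U" using U x by (meson openE subsetD)
    obtain s y where s: "0 < s" "s < min k d" "ball y (\<kappa> * s) \<subseteq> ball x s" "ball y (\<kappa> * s) \<inter> E = {}"
      using por[OF x(1), of "min k d"] x k by auto
    have "ball x s \<subseteq> U" using s k by (meson less_eq_real_def min_less_iff_conj subset_ball subset_trans)
    then show "\<exists>i. i \<in> ?K \<and> x \<in> ball (fst i) (snd i) \<and> snd i < d"
      using s x by (intro exI[of _ "(x, s)"]) auto
  qed auto
  have "\<forall>i\<in>C. \<exists>y. ?P (fst i) (snd i) y" using C(2) by (force simp: case_prod_unfold)
  then obtain Y where Y: "\<And>i. i \<in> C \<Longrightarrow> ?P (fst i) (snd i) (Y i)" by metis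
  let ?B = "\<lambda>i. ball (fst i) (snd i)" and ?H = "\<lambda>i. ball (Y i) (\<kappa> * snd i)"
  define W1 where "W1 = (\<Union>i\<in>C. ?B i)"
  define W2 where "W2 = (\<Union>i\<in>C. ?H i)"
  have disjB: "disjoint_family_on ?B C"
    using pw unfolding disjoint_family_on_def pairwise_def disjnt_def by auto
  have disjH: "disjoint_family_on ?H C"
    using disjB Y unfolding disjoint_family_on_def by fast
  have "emeasure lebesgue W2 = (\<integral>\<^sup>+i. emeasure lebesgue (?H i) \<partial>count_space C)"
    unfolding W2_def using disjH C by (intro emeasure_UN_countable) auto
  also have "\<dots> = (\<integral>\<^sup>+i. ennreal c * emeasure lebesgue (?B i) \<partial>count_space C)"
  proof (intro nn_integral_cong)
    fix i assume "i \<in> space (count_space C)"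
    then have "snd i > 0" using Y by auto
    then show "emeasure lebesgue (?H i) = ennreal c * emeasure lebesgue (?B i)"
      using \<open>\<kappa> > 0\<close> c
      unfolding c_def
      by (simp add: emeasure_ball power_mult_distrib mult_ac flip: ennreal_mult)
  qed
  also have "\<dots> = ennreal c * (\<integral>\<^sup>+i. emeasure lebesgue (?B i) \<partial>count_space C)"
    by (intro nn_integral_cmult) auto
  also have "(\<integral>\<^sup>+i. emeasure lebesgue (?B i) \<partial>count_space C) = emeasure lebesgue W1"
    unfolding W1_def using disjB C by (intro emeasure_UN_countable[symmetric]) auto
  finally have em: "emeasure lebesgue W2 = ennreal c * emeasure lebesgue W1" .
  have sub: "W2 \<subseteq> W1" "W1 \<subseteq> U" "W2 \<inter> E = {}" using Y unfolding W1_def W2_def by fast+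
  have meas: "W1 \<in> sets lebesgue" "W2 \<in> sets lebesgue"
    unfolding W1_def W2_def using C(1) by (auto intro!: sets.countable_UN'')
  have lm: "W1 \<in> lmeasurable" "W2 \<in> lmeasurable"
    using sub U meas by (meson fmeasurableI2 subset_trans)+
  have m2: "measure lebesgue W2 = c * measure lebesgue W1"
    using em c by (simp add: measure_def enn2real_mult)
  have "measure lebesgue E \<le> measure lebesgue W1 - measure lebesgue W2"
  proof -
    have "measure lebesgue E \<le> measure lebesgue ((W1 - W2) \<union> (E - W1))"
      using sub E lm by (intro measure_mono_fmeasurable) auto
    also have "\<dots> = measure lebesgue (W1 - W2)"
      using neg E lm unfolding W1_def[symmetric]
      by (intro measure_Un_null_set) (auto simp: negligible_iff_null_sets)
    also have "\<dots> = measure lebesgue W1 - measure lebesgue W2"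
      using sub lm by (simp add: measurable_measure_Diff fmeasurableD)
    finally show ?thesis .
  qed
  then have le: "measure lebesgue E + c * measure lebesgue W1 \<le> measure lebesgue W1"
    using m2 by simp
  have "measure lebesgue W1 \<le> measure lebesgue U"
    using sub U meas by (intro measure_mono_fmeasurable) auto
  moreover have "0 \<le> c * measure lebesgue W1" using c by simp
  then have "c * measure lebesgue E \<le> c * measure lebesgue W1"
    using le c by (intro mult_left_mono) linarith+
  ultimately show False using U(4) le by linarith
qed

text \<open>A Lipschitz function that leaves its zero set at a linear rate in some direction has a porous zero set.\<close>
lemma negligible_level_set:
  fixes f :: "'a::euclidean_space \<Rightarrow> real"
  assumes E: "E \<in> lmeasurable" and lip: "\<And>p q. \<bar>f p - f q\<bar> \<le> dist p q * K"
    and "K > 0" "\<kappa> > 0"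
    and zero: "\<And>p. p \<in> E \<Longrightarrow> f p = 0"
    and drop: "\<And>p. p \<in> E \<Longrightarrow> \<exists>r>0. \<forall>s. 0 < s \<and> s < r \<longrightarrow> (\<exists>y. dist p y \<le> s \<and> \<bar>f y\<bar> \<ge> \<kappa> * s)"
  shows "negligible E"
proof (rule porous_imp_negligible[OF E, of "(\<kappa> / K) / (1 + \<kappa> / K)"])
  \<comment> \<open>By the Lipschitz bound, f has no zero within \<kappa>' s of y, and this hole
    lies in the ball of radius s (1 + \<kappa>') about p. The ratio of the two radii is the porosity
    constant.\<close>
  define \<kappa>' where "\<kappa>' = \<kappa> / K"
  have k: "\<kappa>' > 0" using assms by (simp add: \<kappa>'_def)
  then show "(\<kappa> / K) / (1 + \<kappa> / K) > 0" unfolding \<kappa>'_def[symmetric] by (auto intro!: divide_pos_pos)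
  fix p and r :: real assume p: "p \<in> E" "r > 0"
  obtain r0 where r0: "r0 > 0" "\<And>s. 0 < s \<Longrightarrow> s < r0 \<Longrightarrow> \<exists>y. dist p y \<le> s \<and> \<bar>f y\<bar> \<ge> \<kappa> * s"
    using drop[OF p(1)] by blast
  define s where "s = min r0 (r / (1 + \<kappa>')) / 2"
  have "r / (1 + \<kappa>') > 0" using p k by simp
  then have "0 < s" "2 * s \<le> r0" "2 * s \<le> r / (1 + \<kappa>')" using r0 by (simp_all add: s_def)
  then have s: "0 < s" "s < r0" "s < r / (1 + \<kappa>')" by linarith+
  obtain y where y: "dist p y \<le> s" "\<bar>f y\<bar> \<ge> \<kappa> * s" using r0(2)[OF s(1,2)] by auto
  have e: "(\<kappa> / K) / (1 + \<kappa> / K) * (s * (1 + \<kappa>')) = \<kappa>' * s"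
    unfolding \<kappa>'_def[symmetric] using k by (simp add: field_simps)
  show "\<exists>s y. 0 < s \<and> s < r \<and> ball y ((\<kappa> / K) / (1 + \<kappa> / K) * s) \<subseteq> ball p s \<and> ball y ((\<kappa> / K) / (1 + \<kappa> / K) * s) \<inter> E = {}"
  proof (intro exI[of _ "s * (1 + \<kappa>')"] exI[of _ y] conjI, unfold e)
    show "0 < s * (1 + \<kappa>')" using s k by simp
    show "s * (1 + \<kappa>') < r" using s k by (simp add: field_simps)
    show "ball y (\<kappa>' * s) \<subseteq> ball p (s * (1 + \<kappa>'))"
    proof
      fix z assume "z \<in> ball y (\<kappa>' * s)"
      then show "z \<in> ball p (s * (1 + \<kappa>'))"
        using y dist_triangle[of p z y] by (simp add: algebra_simps)
    qed
    show "ball y (\<kappa>' * s) \<inter> E = {}"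
    proof (rule ccontr)
      assume "ball y (\<kappa>' * s) \<inter> E \<noteq> {}"
      then obtain z where z: "dist y z < \<kappa>' * s" "z \<in> E" by auto
      have "\<kappa> * s \<le> dist y z * K" using lip[of y z] zero[OF z(2)] y by simp
      also have "\<dots> < \<kappa>' * s * K" using z \<open>K > 0\<close> by simp
      also have "\<dots> = \<kappa> * s" using \<open>K > 0\<close> by (simp add: \<kappa>'_def)
      finally show False by simp
    qed
  qed
qed

text \<open>The measure of the sublevel sets is the distribution function of the image of Lebesgue
  measure on \<open>D\<close> under \<open>\<phi>\<close>. Null level sets mean that the image has
  no atoms, so this function is continuous and the intermediate value theorem applies.\<close>

lemma measure_sublevel_surj:
  fixes \<phi> :: "'a::euclidean_space \<Rightarrow> real"
  assumes D: "D \<in> lmeasurable"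
    and phi: "\<phi> \<in> borel_measurable borel"
    and ab: "\<And>p. p \<in> D \<Longrightarrow> \<phi> p \<in> {a..b}" "a \<le> b"
    and null: "\<And>c. negligible {p \<in> D. \<phi> p = c}"
    and tau: "0 \<le> \<tau>" "\<tau> \<le> measure lebesgue D"
  shows "\<exists>x\<in>{a..b}. measure lebesgue {p \<in> D. \<phi> p \<le> x} = \<tau>"
proof -
  have phi': "\<phi> \<in> borel_measurable (restrict_space lebesgue D)"
    using phi by (intro measurable_restrict_space1) (simp add: measurable_completion)
  define M where "M = distr (restrict_space lebesgue D) borel \<phi>"
  have Dm: "D \<in> sets lebesgue" using D by blast
  have "finite_measure (restrict_space lebesgue D)"
    using D Dm by (auto intro!: finite_measureI simp: emeasure_restrict_space fmeasurable_def)
  then interpret finite_borel_measure M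
    unfolding M_def finite_borel_measure_def finite_borel_measure_axioms_def
    using phi' by (auto intro: finite_measure.finite_measure_distr)
  have meas: "measure M X = measure lebesgue {p \<in> D. \<phi> p \<in> X}" if "X \<in> sets borel" for X
  proof -
    have "measure M X = measure (restrict_space lebesgue D) (\<phi> -` X \<inter> D)"
      unfolding M_def using phi' that by (subst measure_distr) (auto simp: space_restrict_space)
    also have "\<dots> = measure lebesgue (\<phi> -` X \<inter> D)"
      using Dm by (subst measure_restrict_space) auto
    also have "\<phi> -` X \<inter> D = {p \<in> D. \<phi> p \<in> X}" by auto
    finally show ?thesis .
  qed
  have cdf: "cdf M x = measure lebesgue {p \<in> D. \<phi> p \<le> x}" for x
    unfolding cdf_def by (subst meas) auto
  have cont: "isCont (cdf M) x" for x
    unfolding isCont_cdf by (subst meas) (use null[of x] in \<open>auto simp: negligible_imp_measure0\<close>)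
  have a: "cdf M a = 0"
  proof -
    have "{p \<in> D. \<phi> p \<le> a} = {p \<in> D. \<phi> p = a}" using ab by force
    then show ?thesis unfolding cdf using null[of a] by (simp add: negligible_imp_measure0)
  qed
  have b: "cdf M b = measure lebesgue D"
  proof -
    have "{p \<in> D. \<phi> p \<le> b} = D" using ab by auto
    then show ?thesis unfolding cdf by simp
  qed
  have "\<exists>x\<ge>a. x \<le> b \<and> cdf M x = \<tau>"
    using a b tau ab cont by (intro IVT) auto
  then show ?thesis by (auto simp: cdf)
qed

section \<open>Signed distances and their level sets\<close>

lemma frontier_point_between:
  fixes p q :: "'a::euclidean_space"
  assumes "p \<in> A \<longleftrightarrow> q \<notin> A"
  obtains z where "z \<in> frontier A" "dist p q = dist p z + dist z q"
proof -
  have "closed_segment p q \<inter> frontier A \<noteq> {}"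
    using assms by (intro connected_Int_frontier) (use ends_in_segment in blast)+
  then obtain z where "z \<in> closed_segment p q" "z \<in> frontier A" by blast
  then show thesis using that[of z] by (auto simp: between_mem_segment[symmetric] between)
qed

text \<open>If the signs differ, the segment from p to q crosses the frontier, and the two distances
  are bounded by the two pieces of the segment.\<close>

lemma dS_lipschitz: "\<bar>dS p A - dS q A\<bar> \<le> dist p q"
proof (cases "p \<in> A \<longleftrightarrow> q \<in> A")
  case True
  then show ?thesis using infdist_triangle_abs[of p "frontier A" q] by (auto simp: dS_def)
next
  case False
  then obtain z where z: "z \<in> frontier A" "dist p q = dist p z + dist z q"
    using frontier_point_between[of p A q] by blast
  show ?thesis
    using False z infdist_le[of z "frontier A" p] infdist_le[of z "frontier A" q]
      infdist_nonneg[of p "frontier A"] infdist_nonneg[of q "frontier A"]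
    by (auto simp: dS_def dist_commute)
qed

lemma continuous_on_dS [continuous_intros]: "continuous_on X (\<lambda>p. dS p A)"
proof -
  have "1-lipschitz_on X (\<lambda>p. dS p A)"
    using dS_lipschitz by (intro lipschitz_onI) (auto simp: dist_real_def)
  then show ?thesis by (rule lipschitz_on_continuous_on)
qed

lemma frontier_nonempty:
  fixes A :: "'a::euclidean_space set"
  assumes "bounded A" "A \<noteq> {}"
  shows "frontier A \<noteq> {}"
  using assms frontier_not_empty[of A] not_bounded_UNIV by blast

lemma dS_nonneg_iff:
  fixes A :: "'a::euclidean_space set"
  assumes "bounded A" "A \<noteq> {}"
  shows "dS p A \<ge> 0 \<longleftrightarrow> p \<in> closure A"
proof -
  have *: "infdist p (frontier A) = 0 \<longleftrightarrow> p \<in> frontier A"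
    using frontier_nonempty[OF assms] by (simp add: in_closed_iff_infdist_zero)
  have "p \<in> closure A \<longleftrightarrow> p \<in> A \<or> p \<in> frontier A"
    using closure_subset[of A] interior_subset[of A] by (auto simp: frontier_def)
  then show ?thesis using * infdist_nonneg[of p "frontier A"] by (auto simp: dS_def)
qed

lemma dS_pos_iff:
  fixes A :: "'a::euclidean_space set"
  assumes "bounded A" "A \<noteq> {}"
  shows "dS p A > 0 \<longleftrightarrow> p \<in> interior A"
proof -
  have *: "infdist p (frontier A) = 0 \<longleftrightarrow> p \<in> frontier A"
    using frontier_nonempty[OF assms] by (simp add: in_closed_iff_infdist_zero)
  have "p \<in> interior A \<longleftrightarrow> p \<in> A \<and> p \<notin> frontier A"
    using closure_subset[of A] interior_subset[of A] by (auto simp: frontier_def)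
  then show ?thesis using * infdist_nonneg[of p "frontier A"] by (auto simp: dS_def)
qed

text \<open>For p outside A, the segment to a frontier point of B meets the frontier of A, possibly
  only at its end, so the frontier of A is at least as near. For p in B the roles are exchanged; in
  \<open>A - B\<close> the signs decide.\<close>

lemma dS_mono:
  fixes A :: "'a::euclidean_space set"
  assumes "bounded A" "B \<subseteq> A" "B \<noteq> {}"
  shows "dS p B \<le> dS p A"
proof -
  have ne: "frontier A \<noteq> {}" "frontier B \<noteq> {}"
    using assms frontier_nonempty bounded_subset by blast+
  consider "p \<notin> A" | "p \<in> B" | "p \<in> A" "p \<notin> B" by blast
  then show ?thesis
  proof cases
    case 1
    have "infdist p (frontier A) \<le> dist p b" if b: "b \<in> frontier B" for b
    proof (cases "b \<in> A")
      case True
      then obtain z where "z \<in> frontier A" "dist p b = dist p z + dist z b"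
        using 1 frontier_point_between[of p A b] by blast
      then show ?thesis using infdist_le[of z "frontier A" p] zero_le_dist[of z b] by linarith
    next
      case False
      have "b \<in> closure A" using b assms(2) closure_mono by (auto simp: frontier_def)
      then have "b \<in> frontier A" using False interior_subset by (auto simp: frontier_def)
      then show ?thesis by (rule infdist_le)
    qed
    then have "infdist p (frontier A) \<le> infdist p (frontier B)"
      using ne by (subst (2) infdist_notempty) (auto intro: cINF_greatest)
    then show ?thesis using 1 assms by (auto simp: dS_def)
  next
    case 2
    have "infdist p (frontier B) \<le> dist p a" if a: "a \<in> frontier A" for a
    proof (cases "a \<in> B")
      case False
      then obtain z where "z \<in> frontier B" "dist p a = dist p z + dist z a"
        using 2 frontier_point_between[of p B a] by blast
      then show ?thesis using infdist_le[of z "frontier B" p] zero_le_dist[of z a] by linarith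
    next
      case True
      then have "a \<in> frontier B" using a assms(2) closure_subset interior_mono[OF assms(2)]
        by (auto simp: frontier_def)
      then show ?thesis by (rule infdist_le)
    qed
    then have "infdist p (frontier B) \<le> infdist p (frontier A)"
      using ne by (subst (2) infdist_notempty) (auto intro: cINF_greatest)
    then show ?thesis using 2 assms by (auto simp: dS_def)
  next
    case 3
    then show ?thesis using infdist_nonneg[of p "frontier A"] infdist_nonneg[of p "frontier B"]
      by (simp add: dS_def)
  qed
qed

lemma dS_singleton: "dS p {q} = - norm (p - q)" for p q :: "'a::euclidean_space"
proof -
  have "frontier {q} = {q}" by (simp add: frontier_def interior_singleton)
  then show ?thesis by (auto simp: dS_def dist_norm)
qed

section \<open>Null level sets of distance functions\<close>

text \<open>One nearest point a serves all step lengths s, so the distance to X falls at unit speed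
  along a straight line. This movement underlies every porosity estimate below.\<close>

lemma infdist_step_towards:
  fixes p :: "'a::euclidean_space"
  assumes "closed X" "X \<noteq> {}"
  shows "\<exists>a\<in>X. infdist p X = dist p a \<and>
    (\<forall>s. 0 \<le> s \<and> s \<le> infdist p X \<longrightarrow> dist p (p + (s / infdist p X) *\<^sub>R (a - p)) \<le> s \<and>
        infdist (p + (s / infdist p X) *\<^sub>R (a - p)) X \<le> infdist p X - s)"
proof -
  obtain a where a: "a \<in> X" "infdist p X = dist p a"
    using infdist_attains_inf[OF assms] by metis
  have "dist p (p + (s / infdist p X) *\<^sub>R (a - p)) \<le> s \<and>
        infdist (p + (s / infdist p X) *\<^sub>R (a - p)) X \<le> infdist p X - s"
    if s: "0 \<le> s" "s \<le> infdist p X" for s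
  proof (cases "infdist p X = 0")
    \<comment> \<open>Here \<open>s = 0\<close>, and division by zero yields 0, so the moved point
      is p itself.\<close>
    case True
    then show ?thesis using s by simp
  next
    case False
    define \<rho> where "\<rho> = infdist p X"
    have r: "\<rho> > 0" "\<rho> = norm (a - p)" using False a by (auto simp: \<rho>_def dist_norm norm_minus_commute infdist_nonneg less_le)
    have 1: "dist p (p + (s / \<rho>) *\<^sub>R (a - p)) \<le> s" using r s by (simp add: dist_norm)
    have "p + (s / \<rho>) *\<^sub>R (a - p) - a = (1 - s / \<rho>) *\<^sub>R (p - a)" by (simp add: algebra_simps)
    then have "dist (p + (s / \<rho>) *\<^sub>R (a - p)) a = \<bar>1 - s / \<rho>\<bar> * \<rho>"
      using r by (simp add: dist_norm norm_minus_commute)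
    also have "\<dots> = \<rho> - s" using r s by (simp add: \<rho>_def[symmetric] field_simps)
    finally have "infdist (p + (s / \<rho>) *\<^sub>R (a - p)) X \<le> \<rho> - s" using infdist_le[OF a(1)] by metis
    with 1 show ?thesis by (simp add: \<rho>_def)
  qed
  then show ?thesis using a by blast
qed

lemma lmeasurable_level:
  fixes f :: "'a::euclidean_space \<Rightarrow> real"
  assumes "D \<in> lmeasurable" "continuous_on UNIV f"
  shows "{p \<in> D. f p = c} \<in> lmeasurable"
proof -
  have "closed {p. f p = c}" using assms by (intro closed_Collect_eq) (auto intro: continuous_intros)
  then have "{p. f p = c} \<in> sets lebesgue" by (simp add: borel_closed)
  then have "D \<inter> {p. f p = c} \<in> lmeasurable" using assms by (intro fmeasurable_Int_fmeasurable)
  then show ?thesis by (simp add: Int_def)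
qed

lemma negligible_infdist_level:
  fixes B :: "'a::euclidean_space set"
  assumes D: "D \<in> lmeasurable" and B: "closed B" "B \<noteq> {}" and "r > 0"
  shows "negligible {p \<in> D. infdist p B = r}"
proof (rule negligible_level_set[where f = "\<lambda>p. infdist p B - r" and K = 1 and \<kappa> = 1])
  show "{p \<in> D. infdist p B = r} \<in> lmeasurable"
    using D by (intro lmeasurable_level) (auto intro!: continuous_intros)
  fix p assume p: "p \<in> {p \<in> D. infdist p B = r}"
  have "\<exists>y. dist p y \<le> s \<and> infdist y B \<le> r - s" if "0 < s" "s < r" for s
    using infdist_step_towards[OF B, of p] p that less_imp_le by blast
  then show "\<exists>r'>0. \<forall>s. 0 < s \<and> s < r' \<longrightarrow> (\<exists>y. dist p y \<le> s \<and> 1 * s \<le> \<bar>infdist y B - r\<bar>)"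
    using \<open>r > 0\<close> by (intro exI[of _ r]) force
qed (use infdist_triangle_abs in auto)

text \<open>For c outside (0,1) the equation has no solution, as \<open>dS\<close> is positive for A
  and negative for B. Otherwise it equates the weighted distances to the two frontiers. A step s
  towards the frontier with the larger weight lowers its term by at least that weight times s, the
  other term by at most the smaller weight times s. The gap opens at rate |2 c - 1|, which vanishes
  at 1/2.\<close>

lemma negligible_weighted_dS_level:
  fixes A B :: "'a::euclidean_space set"
  assumes A: "bounded A" and ne: "B \<noteq> {}" "B \<subseteq> A" "closed B"
    and D: "interior A - B \<in> lmeasurable" and "c \<noteq> 1/2"
  shows "negligible {p \<in> interior A - B. c * dS p A + (1 - c) * dS p B = 0}" (is "negligible ?E")
proof -
  have fr: "frontier A \<noteq> {}" "frontier B \<noteq> {}"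
    using assms frontier_nonempty bounded_subset by blast+
  have bB: "bounded B" using A ne bounded_subset by blast
  have pos: "dS p A > 0" "dS p B < 0" "dS p A = infdist p (frontier A)" "dS p B = - infdist p (frontier B)"
    if "p \<in> interior A - B" for p
  proof -
    have "A \<noteq> {}" "p \<in> A" "p \<notin> B" using that ne interior_subset by auto
    then show "dS p A > 0" "dS p B < 0" "dS p A = infdist p (frontier A)" "dS p B = - infdist p (frontier B)"
      using that dS_pos_iff[OF A, of p] dS_nonneg_iff[OF bB, of p] ne
      by (simp, metis closure_closed not_le, simp_all add: dS_def)
  qed
  show ?thesis
  proof (cases "0 < c \<and> c < 1")
    case False
    have "?E = {}"
    proof (rule ccontr)
      assume "?E \<noteq> {}"
      then obtain p where p: "p \<in> interior A - B" "c * dS p A + (1 - c) * dS p B = 0" by blast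
      define a b where "a = dS p A" and "b = - dS p B"
      have ab: "a > 0" "b > 0" "c * a = (1 - c) * b" using pos[OF p(1)] p(2) by (auto simp: a_def b_def)
      then have "c = b / (a + b)" by (simp add: field_simps)
      then have "0 < c \<and> c < 1" using ab by simp
      then show False using False by simp
    qed
    then show ?thesis by (simp only: negligible_empty)
  next
    case True
    define f where "f p = c * infdist p (frontier A) - (1 - c) * infdist p (frontier B)" for p
    have E: "?E \<in> lmeasurable"
      using D by (intro lmeasurable_level) (auto intro!: continuous_intros)
    show ?thesis
    proof (rule negligible_level_set[OF E, where f = f and K = 1 and \<kappa> = "\<bar>2 * c - 1\<bar>"])
      show "\<bar>f p - f q\<bar> \<le> dist p q * 1" for p q
      proof -
        have "\<bar>f p - f q\<bar> \<le> \<bar>c * (infdist p (frontier A) - infdist q (frontier A))\<bar> + \<bar>(1 - c) * (infdist p (frontier B) - infdist q (frontier B))\<bar>"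
          unfolding f_def by (simp add: algebra_simps)
        also have "\<dots> \<le> c * dist p q + (1 - c) * dist p q"
          using True infdist_triangle_abs[of p _ q] by (auto simp: abs_mult intro!: add_mono mult_left_mono)
        finally show ?thesis by (simp add: algebra_simps)
      qed
      show "\<bar>2 * c - 1\<bar> > 0" using \<open>c \<noteq> 1/2\<close> by auto
      show "f p = 0" if "p \<in> ?E" for p using that pos[of p] by (auto simp: f_def)
      fix p assume p: "p \<in> ?E"
      then have pp: "infdist p (frontier A) > 0" "infdist p (frontier B) > 0" and f0: "f p = 0"
        using pos[of p] by (auto simp: f_def)
      \<comment> \<open>The larger weight belongs to the frontier nearer to p, since the weighted
        distances are equal.\<close>
      define X where "X = (if c > 1/2 then frontier A else frontier B)"
      define Y where "Y = (if c > 1/2 then frontier B else frontier A)"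
      have X: "closed X" "X \<noteq> {}" using fr by (auto simp: X_def)
      obtain a where "a \<in> X" "infdist p X = dist p a" and
        a: "\<And>s. 0 \<le> s \<Longrightarrow> s \<le> infdist p X \<Longrightarrow> dist p (p + (s / infdist p X) *\<^sub>R (a - p)) \<le> s \<and>
        infdist (p + (s / infdist p X) *\<^sub>R (a - p)) X \<le> infdist p X - s"
        using infdist_step_towards[OF X, of p] by blast
      show "\<exists>r>0. \<forall>s. 0 < s \<and> s < r \<longrightarrow> (\<exists>y. dist p y \<le> s \<and> \<bar>2 * c - 1\<bar> * s \<le> \<bar>f y\<bar>)"
      proof (intro exI[of _ "infdist p X"] conjI allI impI)
        show "infdist p X > 0" using pp by (simp add: X_def)
        fix s assume s: "0 < s \<and> s < infdist p X"
        define y where "y = p + (s / infdist p X) *\<^sub>R (a - p)"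
        have y: "dist p y \<le> s" "infdist y X \<le> infdist p X - s" using a[of s] s unfolding y_def by auto
        have y': "infdist y Y \<ge> infdist p Y - s" using infdist_triangle[of p Y y] y(1) by linarith
        note yy = y(2)[unfolded X_def] y'[unfolded Y_def]
        have "\<bar>2 * c - 1\<bar> * s \<le> \<bar>f y\<bar>"
        proof (cases "c > 1/2")
          case c: True
          have "f y \<le> c * (infdist p (frontier A) - s) - (1 - c) * (infdist p (frontier B) - s)"
            unfolding f_def using c yy True by (intro diff_mono mult_left_mono) auto
          also have "\<dots> = - ((2 * c - 1) * s)" using f0 by (simp add: f_def algebra_simps)
          finally show ?thesis using c by simp
        next
          case c: False
          have "f y \<ge> c * (infdist p (frontier A) - s) - (1 - c) * (infdist p (frontier B) - s)"
            unfolding f_def using c yy True by (intro diff_mono mult_left_mono) auto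
          moreover have "c * (infdist p (frontier A) - s) - (1 - c) * (infdist p (frontier B) - s) = (1 - 2 * c) * s"
            using f0 by (simp add: f_def algebra_simps)
          ultimately show ?thesis using c by simp
        qed
        then show "\<exists>y. dist p y \<le> s \<and> \<bar>2 * c - 1\<bar> * s \<le> \<bar>f y\<bar>" using y by blast
      qed
    qed simp
  qed
qed

text \<open>Walking from a point of the level set straight to a nearest frontier point \<open>a\<close> decreases the
  distance to the frontier at unit speed, but the distance to \<open>q\<close> at a smaller speed, because \<open>a \<noteq> q\<close>.\<close>
lemma negligible_equidistant_interior_point:
  fixes A :: "'a::euclidean_space set"
  assumes A: "bounded A" and q: "q \<in> interior A" and D: "interior A - {q} \<in> lmeasurable"
  shows "negligible {p \<in> interior A - {q}. infdist p (frontier A) = dist p q}" (is "negligible ?E")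
proof -
  have ne: "A \<noteq> {}" using q interior_subset by blast
  have fr: "frontier A \<noteq> {}" using frontier_nonempty A ne by blast
  define d where "d = infdist q (frontier A)"
  have d: "d > 0" using dS_pos_iff[OF A ne, of q] q interior_subset[of A] by (auto simp: d_def dS_def split: if_splits)
  define R where "R = diameter A"
  define f where "f p = infdist p (frontier A) - dist p q" for p
  have E: "?E \<in> lmeasurable"
  proof -
    have "?E = {p \<in> interior A - {q}. f p = 0}" by (auto simp: f_def)
    moreover have "continuous_on UNIV f" unfolding f_def by (intro continuous_intros)
    ultimately show ?thesis using lmeasurable_level[OF D, of f 0] by simp
  qed
  have R: "dist p q \<le> R" if "p \<in> interior A" for p
    using diameter_bounded_bound[OF A, of p q] that q interior_subset by (auto simp: R_def)
  show ?thesis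
  proof (cases "R > 0")
    case False
    have "?E = {}"
    proof (rule ccontr)
      assume "?E \<noteq> {}"
      then obtain p where "p \<in> interior A" "p \<noteq> q" by blast
      then show False using R[of p] False zero_less_dist_iff[of p q] by linarith
    qed
    then show ?thesis by (metis negligible_empty)
  next
    case True
    show ?thesis
    proof (rule negligible_level_set[OF E, where f = f and K = 2 and \<kappa> = "d\<^sup>2 / (2 * R\<^sup>2)"])
      show "\<bar>f x - f y\<bar> \<le> dist x y * 2" for x y
        using infdist_triangle_abs[of x "frontier A" y] abs_dist_diff_le[of x q y] dist_commute[of q y]
        unfolding f_def by linarith
      show "0 < d\<^sup>2 / (2 * R\<^sup>2)" using d True by simp
      show "f p = 0" if "p \<in> ?E" for p using that by (auto simp: f_def)
      fix p assume p: "p \<in> ?E"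
      define \<rho> where "\<rho> = infdist p (frontier A)"
      obtain a where a: "a \<in> frontier A" "\<rho> = dist p a" and
        step: "\<And>s. 0 \<le> s \<Longrightarrow> s \<le> \<rho> \<Longrightarrow> dist p (p + (s / \<rho>) *\<^sub>R (a - p)) \<le> s \<and>
        infdist (p + (s / \<rho>) *\<^sub>R (a - p)) (frontier A) \<le> \<rho> - s"
        using infdist_step_towards[OF frontier_closed fr, of p] unfolding \<rho>_def by blast
      have rq: "\<rho> = dist p q" "\<rho> > 0" "\<rho> \<le> R" using p R by (auto simp: \<rho>_def)
      have aq: "d \<le> dist q a" using infdist_le[OF a(1)] by (simp add: d_def)
      show "\<exists>r>0. \<forall>s. 0 < s \<and> s < r \<longrightarrow> (\<exists>y. dist p y \<le> s \<and> d\<^sup>2 / (2 * R\<^sup>2) * s \<le> \<bar>f y\<bar>)"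
      proof (intro exI[of _ \<rho>] conjI allI impI)
        show "\<rho> > 0" by fact
        fix s assume s: "0 < s \<and> s < \<rho>"
        define y where "y = p + (s / \<rho>) *\<^sub>R (a - p)"
        have y: "dist p y \<le> s" "infdist y (frontier A) \<le> \<rho> - s" using step[of s] s by (auto simp: y_def)
        \<comment> \<open>u and v have the same length \<rho> and their difference has length at
          least d, so the angle between them is bounded away from 0 and the law of cosines makes
          \<open>dist y q\<close> exceed \<rho> - s. Factoring the difference of squares, with
          \<open>w + (\<rho> - s) \<le> 2 * R\<close>, gives the rate
          \<open>d\<^sup>2 / (2 * R\<^sup>2)\<close>.\<close>
        define u v where "u = a - p" and "v = q - p"
        have uv: "u \<bullet> u = \<rho>\<^sup>2" "v \<bullet> v = \<rho>\<^sup>2" "(v - u) \<bullet> (v - u) = (dist q a)\<^sup>2"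
          using a rq by (auto simp: u_def v_def dist_norm power2_norm_eq_inner[symmetric] norm_minus_commute)
        have "(dist y q)\<^sup>2 = (v - (s / \<rho>) *\<^sub>R u) \<bullet> (v - (s / \<rho>) *\<^sub>R u)"
          by (simp add: y_def u_def v_def dist_norm power2_norm_eq_inner[symmetric] norm_minus_commute algebra_simps)
        also have "\<dots> = v \<bullet> v - 2 * (s / \<rho>) * (v \<bullet> u) + (s / \<rho>)\<^sup>2 * (u \<bullet> u)"
          by (simp add: inner_diff_left inner_diff_right inner_commute power2_eq_square algebra_simps)
        also have "v \<bullet> u = \<rho>\<^sup>2 - (dist q a)\<^sup>2 / 2"
          using uv by (simp add: inner_diff_left inner_diff_right inner_commute algebra_simps)
        also have "v \<bullet> v - 2 * (s / \<rho>) * (\<rho>\<^sup>2 - (dist q a)\<^sup>2 / 2) + (s / \<rho>)\<^sup>2 * (u \<bullet> u) = (\<rho> - s)\<^sup>2 + s * (dist q a)\<^sup>2 / \<rho>"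
          using rq unfolding uv by (simp add: field_simps power2_eq_square)
        finally have sq: "(dist y q)\<^sup>2 = (\<rho> - s)\<^sup>2 + s * (dist q a)\<^sup>2 / \<rho>" .
        define w where "w = dist y q"
        have w: "w \<le> \<rho> + s" using y rq dist_triangle[of y q p] by (simp add: w_def dist_commute)
        have "dist q a > 0" using aq d by linarith
        then have "s * (dist q a)\<^sup>2 / \<rho> > 0" using s rq(2) by (intro divide_pos_pos mult_pos_pos zero_less_power) auto
        then have "w\<^sup>2 > (\<rho> - s)\<^sup>2" using sq by (simp add: w_def)
        then have ws: "w > \<rho> - s" using power_less_imp_less_base[of "\<rho> - s" 2 w] by (simp add: w_def)
        have "s * d\<^sup>2 / R \<le> s * (dist q a)\<^sup>2 / \<rho>"
          using s aq d rq True by (intro frac_le mult_left_mono power_mono) auto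
        also have "\<dots> = (w - (\<rho> - s)) * (w + (\<rho> - s))" using sq by (simp add: w_def power2_eq_square algebra_simps)
        also have "\<dots> \<le> (w - (\<rho> - s)) * (2 * R)" using ws w rq by (intro mult_left_mono) auto
        finally have "d\<^sup>2 / (2 * R\<^sup>2) * s \<le> w - (\<rho> - s)"
          using True by (simp add: field_simps power2_eq_square)
        then have "d\<^sup>2 / (2 * R\<^sup>2) * s \<le> \<bar>f y\<bar>" using y by (simp add: f_def w_def)
        then show "\<exists>y. dist p y \<le> s \<and> d\<^sup>2 / (2 * R\<^sup>2) * s \<le> \<bar>f y\<bar>" using y by blast
      qed
    qed simp
  qed
qed

section \<open>Distance averages of nested pairs\<close>

lemma JnD:
  assumes "A \<in> Jn"
  shows "closed A" "bounded A" "negligible (frontier A)" "A \<in> lmeasurable" "closure (interior A) = A"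
proof -
  show "bounded A" "negligible (frontier A)" "closure (interior A) = A"
    using assms by (auto simp: Jn_def ci_def negligible_iff_null_sets)
  then show "closed A" "A \<in> lmeasurable" using measurable_Jordan by (metis closed_closure, blast)
qed

text \<open>\<open>G\<close> stays in the interior of \<open>ci S\<close>, so the frontier of
  \<open>ci S\<close> lies in the null set \<open>F - G\<close>. Together with
  \<open>measure_eq_sandwich\<close>, this shows that regularising changes no measure.\<close>

lemma ci_in_Jn:
  fixes S :: "'a::euclidean_space set"
  assumes "open G" "G \<subseteq> S" "S \<subseteq> F" "closed F" "bounded F" "negligible (F - G)"
  shows "ci S \<in> Jn" "G \<subseteq> ci S" "ci S \<subseteq> F"
proof -
  have GS: "G \<subseteq> interior S" using assms by (simp add: interior_maximal)
  then show G: "G \<subseteq> ci S" unfolding ci_def using closure_subset by blast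
  show F: "ci S \<subseteq> F" unfolding ci_def using assms interior_subset by (meson closure_minimal subset_trans)
  have "G \<subseteq> interior (ci S)" using G assms by (simp add: interior_maximal)
  then have "frontier (ci S) \<subseteq> F - G" using F by (auto simp: frontier_def ci_def)
  then have "negligible (frontier (ci S))" using assms negligible_subset by blast
  moreover have "ci (ci S) = ci S"
    unfolding ci_def
    by (metis closure_closure closure_mono closure_subset interior_interior interior_mono interior_subset order_antisym)
  ultimately show "ci S \<in> Jn"
    using F assms bounded_subset by (auto simp: Jn_def negligible_iff_null_sets)
qed

lemma measure_eq_sandwich:
  fixes X Y :: "'a::euclidean_space set"
  assumes "G \<subseteq> X" "X \<subseteq> F" "G \<subseteq> Y" "Y \<subseteq> F" "negligible (F - G)" "X \<in> lmeasurable"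
  shows "measure lebesgue Y = measure lebesgue X"
  using assms by (intro measure_negligible_symdiff negligible_subset[OF assms(5)]) auto

section \<open>The one-parameter family of superlevel sets of a nested pair\<close>

text \<open>Weaker than membership in \<open>Jn\<close> on purpose: A will be
  \<open>B \<union> C\<close> for a component or a merged union C, and B may be a single point
  standing in for the empty set.\<close>

locale nested_pair =
  fixes A B :: "'a::euclidean_space set"
  assumes A: "bounded A" "negligible (frontier A)"
    and B: "closed B" "B \<noteq> {}" "B \<subseteq> A" "negligible (frontier B)"
begin

definition f :: "real \<Rightarrow> 'a \<Rightarrow> real" where "f x p = x * dS p A + (1 - x) * dS p B"

lemma facts: "A \<noteq> {}" "bounded B" "A \<in> lmeasurable" "B \<in> lmeasurable" "interior A - B \<in> lmeasurable"
proof -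
  show "A \<noteq> {}" "bounded B" using B A bounded_subset by blast+
  then show "A \<in> lmeasurable" "B \<in> lmeasurable" using A B by (auto intro: measurable_Jordan)
  then show "interior A - B \<in> lmeasurable"
    using A lmeasurable_interior[of A] by (auto intro: fmeasurable_Diff)
qed

text \<open>Expansions around x = 0 and x = 1. By \<open>dS_le\<close> the slope in x is
  nonnegative, so the inclusions between superlevel sets, A and B can be read off.\<close>

lemma f_alt: "f x p = dS p B + x * (dS p A - dS p B)" "f x p = dS p A + (x - 1) * (dS p A - dS p B)"
  and dS_le: "dS p B \<le> dS p A"
  using dS_mono[OF A(1) B(3,2), of p] by (auto simp: f_def algebra_simps)

lemma signs:
  "dS p A \<ge> 0 \<longleftrightarrow> p \<in> closure A" "dS p B \<ge> 0 \<longleftrightarrow> p \<in> B"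
  "dS p A > 0 \<longleftrightarrow> p \<in> interior A" "dS p B > 0 \<longleftrightarrow> p \<in> interior B"
  using dS_nonneg_iff[OF A(1) facts(1)] dS_nonneg_iff[OF facts(2) B(2)]
    dS_pos_iff[OF A(1) facts(1)] dS_pos_iff[OF facts(2) B(2)] B(1) by auto

lemma continuous_f: "continuous_on UNIV (f x)"
  unfolding f_def by (intro continuous_intros)

lemma closed_superlevel: "closed {p. f x p \<ge> 0}"
  using continuous_f by (intro closed_Collect_le) (auto intro: continuous_intros)

lemma superlevel_between:
  assumes "0 \<le> x" "x \<le> 1" shows "B \<subseteq> {p. f x p \<ge> 0}" "{p. f x p \<ge> 0} \<subseteq> closure A"
proof -
  have "dS p B \<le> f x p" for p unfolding f_alt(1) using assms dS_le[of p] by simp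
  then show "B \<subseteq> {p. f x p \<ge> 0}" using signs order_trans by blast
  have "(x - 1) * (dS p A - dS p B) \<le> 0" for p using assms dS_le[of p] by (intro mult_nonpos_nonneg) auto
  then have "f x p \<le> dS p A" for p unfolding f_alt(2) by (metis add_le_same_cancel1)
  then show "{p. f x p \<ge> 0} \<subseteq> closure A" using signs(1) order_trans by blast
qed

lemma superlevel_ge_1:
  assumes "x \<ge> 1" shows "A \<subseteq> {p. f x p \<ge> 0}"
proof
  fix p assume "p \<in> A"
  then have "dS p A \<ge> 0" using signs closure_subset by blast
  then show "p \<in> {p. f x p \<ge> 0}" unfolding f_alt(2) using assms dS_le[of p] by simp
qed

lemma superlevel_le_0:
  assumes "x \<le> 0" shows "{p. f x p \<ge> 0} \<subseteq> B"
proof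
  fix p assume p: "p \<in> {p. f x p \<ge> 0}"
  have "x * (dS p A - dS p B) \<le> 0" using assms dS_le[of p] by (intro mult_nonpos_nonneg) auto
  then have "dS p B \<ge> 0" using p f_alt(1)[of x p] by auto
  then show "p \<in> B" using signs by blast
qed

text \<open>The case x \<ge> 1 matters because the minimiser \<open>g\<close> ranges over [-N, N].
  The weight of B is then not positive, but the weights still add up to 1, so outside A the value is
  at most - norm p + (2 x - 1) R, where R bounds \<open>closure A\<close>.\<close>

lemma bounded_superlevel: "bounded {p. f x p \<ge> 0}"
proof (cases "x \<ge> 1")
  case False
  then show ?thesis
    using superlevel_between(2)[of x] superlevel_le_0[of x] A facts bounded_subset
    by (metis bounded_closure linorder_not_le nle_le)
next
  case True
  obtain R where R: "\<And>p. p \<in> closure A \<Longrightarrow> norm p \<le> R" using A bounded_closure bounded_iff by metis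
  have fA: "norm z \<le> R" if "z \<in> frontier A" for z using R that by (auto simp: frontier_def)
  have fB: "norm z \<le> R" if "z \<in> frontier B" for z
    using R that frontier_subset_closed B closure_subset by blast
  obtain b where b: "b \<in> frontier B" using frontier_nonempty facts B by blast
  have "norm p \<le> max R ((2 * x - 1) * R)" if p: "f x p \<ge> 0" for p
  proof (cases "p \<in> A")
    case True
    then show ?thesis using R[of p] closure_subset[of A] by auto
  next
    case False
    have "norm p - R \<le> infdist p (frontier A)"
    proof (subst infdist_notempty)
      show "frontier A \<noteq> {}" using frontier_nonempty A facts by blast
      then show "norm p - R \<le> (INF a\<in>frontier A. dist p a)"
      proof (rule cINF_greatest)
        fix z assume "z \<in> frontier A"
        then show "norm p - R \<le> dist p z" using fA[of z] norm_triangle_ineq2[of p z] by (simp add: dist_norm)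
      qed
    qed
    moreover have "infdist p (frontier B) \<le> norm p + R"
      using infdist_le[OF b, of p] fB[OF b] norm_triangle_ineq4[of p b] by (simp add: dist_norm)
    moreover have "f x p = - (x * infdist p (frontier A)) + (x - 1) * infdist p (frontier B)"
      using False B by (auto simp: f_def dS_def algebra_simps)
    ultimately have "f x p \<le> - (x * (norm p - R)) + (x - 1) * (norm p + R)"
      using \<open>x \<ge> 1\<close> by (simp only:) (intro add_mono le_imp_neg_le mult_left_mono; simp)
    then have "norm p \<le> (2 * x - 1) * R" using p by (simp add: algebra_simps)
    then show ?thesis by simp
  qed
  then show ?thesis unfolding bounded_iff by blast
qed

text \<open>The value is negative outside \<open>closure A\<close> and positive on
  \<open>interior B\<close>, so beyond \<open>interior A - B\<close> only the null frontiers remain.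
  The premise for x = 1/2 is where the zero-measure condition enters.\<close>

lemma negligible_zero_set:
  assumes x: "0 \<le> x" "x \<le> 1" and z: "x = 1/2 \<Longrightarrow> negligible {p \<in> interior A - B. f (1/2) p = 0}"
  shows "negligible {p. f x p = 0}"
proof -
  have "negligible {p \<in> interior A - B. f x p = 0}"
    using negligible_weighted_dS_level[OF A(1) B(2,3,1) facts(5), of x] z
    unfolding f_def[symmetric] by metis
  moreover have "{p. f x p = 0} \<subseteq> {p \<in> interior A - B. f x p = 0} \<union> frontier A \<union> frontier B"
  proof
    fix p assume p: "p \<in> {p. f x p = 0}"
    then have "p \<in> closure A" using superlevel_between[OF x] by auto
    moreover have "p \<notin> interior B"
    proof
      assume "p \<in> interior B"
      then have "dS p B > 0" using signs by blast
      moreover have "f x p \<ge> dS p B" unfolding f_alt(1) using x dS_le[of p] by simp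
      ultimately show False using p by simp
    qed
    moreover have "p \<in> frontier B" if "p \<in> B" "p \<notin> interior B"
      using that closure_subset by (auto simp: frontier_def)
    ultimately show "p \<in> {p \<in> interior A - B. f x p = 0} \<union> frontier A \<union> frontier B"
      using p by (auto simp: frontier_def)
  qed
  ultimately show ?thesis using A B by (meson negligible_Un negligible_subset)
qed

lemma superlevel_lmeasurable: "{p. f x p \<ge> 0} \<in> lmeasurable"
  using closed_superlevel bounded_superlevel by (intro lmeasurable_compact) (simp add: compact_eq_bounded_closed)

lemma measure_superlevel_surj:
  assumes z: "negligible {p \<in> interior A - B. f (1/2) p = 0}"
    and t: "0 \<le> t" "t \<le> 1"
  shows "\<exists>x\<in>{0..1}. measure lebesgue {p. f x p \<ge> 0} = t * measure lebesgue A + (1 - t) * measure lebesgue B"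
proof -
  define D where "D = interior A - B"
  \<comment> \<open>\<open>\<phi> p\<close> is the parameter x at which \<open>f x p\<close>
    vanishes. As \<open>f x p\<close> increases with x, the superlevel sets of \<open>f x\<close>
    within \<open>D\<close> are the sublevel sets of \<open>\<phi>\<close>.\<close>
  define \<phi> where "\<phi> p = dS p B / (dS p B - dS p A)" for p
  have D: "dS p A > 0" "dS p B < 0" if "p \<in> D" for p
    using that signs(2,3)[of p] by (auto simp: D_def not_le)
  have phi: "0 < \<phi> p" "\<phi> p < 1" "\<phi> p \<le> x \<longleftrightarrow> f x p \<ge> 0" "\<phi> p = x \<longleftrightarrow> f x p = 0" if "p \<in> D" for p x
  proof -
    define a b where "a = dS p A" and "b = - dS p B"
    have ab: "a > 0" "b > 0" "\<phi> p = b / (a + b)" "f x p = x * (a + b) - b"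
      using D[OF that] by (auto simp: a_def b_def \<phi>_def f_def algebra_simps minus_divide_left[symmetric]
          nonzero_minus_divide_right)
    show "0 < \<phi> p" "\<phi> p < 1" "\<phi> p \<le> x \<longleftrightarrow> f x p \<ge> 0" "\<phi> p = x \<longleftrightarrow> f x p = 0"
      unfolding ab(3,4) using ab(1,2) by (auto simp: field_simps)
  qed
  have "(\<lambda>p. dS p A) \<in> borel_measurable borel" "(\<lambda>p. dS p B) \<in> borel_measurable borel"
    by (auto intro!: borel_measurable_continuous_onI continuous_intros)
  then have meas: "\<phi> \<in> borel_measurable borel" unfolding \<phi>_def by measurable
  have null: "negligible {p \<in> D. \<phi> p = c}" for c
  proof -
    have "{p \<in> D. \<phi> p = c} = {p \<in> interior A - B. f c p = 0}" using phi(4) by (auto simp: D_def)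
    moreover have "negligible \<dots>"
      using negligible_weighted_dS_level[OF A(1) B(2,3,1) facts(5), of c] z
      unfolding f_def[symmetric] by metis
    ultimately show ?thesis by simp
  qed
  have Dl: "D \<in> lmeasurable" using facts by (simp add: D_def)
  have mD: "measure lebesgue A = measure lebesgue B + measure lebesgue D"
  proof -
    have "measure lebesgue (B \<union> D) = measure lebesgue A"
      using facts B interior_subset[of A] closure_subset[of A] A
      by (intro measure_negligible_symdiff negligible_subset[OF A(2)]) (auto simp: D_def frontier_def)
    moreover have "measure lebesgue (B \<union> D) = measure lebesgue B + measure lebesgue D"
      using facts Dl by (intro measure_Un2[THEN trans]) (auto simp: D_def)
    ultimately show ?thesis by simp
  qed
  obtain x where x: "x \<in> {0..1}" "measure lebesgue {p \<in> D. \<phi> p \<le> x} = t * measure lebesgue D"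
    using measure_sublevel_surj[OF Dl meas _ _ null, of 0 1 "t * measure lebesgue D"] phi(1,2) t
    by (auto simp: less_imp_le mult_left_le_one_le)
  have eq: "{p \<in> D. \<phi> p \<le> x} = {p. f x p \<ge> 0} \<inter> D" using phi(3) by auto
  have "measure lebesgue {p. f x p \<ge> 0} = measure lebesgue (B \<union> ({p. f x p \<ge> 0} \<inter> D))"
    using superlevel_between[of x] x superlevel_lmeasurable[of x] facts Dl
    by (intro measure_negligible_symdiff[symmetric] negligible_subset[OF A(2)]) (auto simp: D_def frontier_def)
  also have "\<dots> = measure lebesgue B + measure lebesgue ({p. f x p \<ge> 0} \<inter> D)"
  proof -
    have "{p. f x p \<ge> 0} \<inter> D \<in> lmeasurable" using superlevel_lmeasurable Dl by blast
    then show ?thesis using facts by (intro measure_Un2[THEN trans]) (auto simp: D_def intro!: arg_cong[where f="measure lebesgue"])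
  qed
  also have "\<dots> = measure lebesgue B + t * measure lebesgue D" using x eq by simp
  also have "\<dots> = t * measure lebesgue A + (1 - t) * measure lebesgue B" using mD by (simp add: algebra_simps)
  finally show ?thesis using x by blast
qed

lemma ci_superlevel:
  assumes h: "measure lebesgue {p. f x p \<ge> 0} = t * measure lebesgue A + (1 - t) * measure lebesgue B"
    and z: "x = 1/2 \<Longrightarrow> negligible {p \<in> interior A - B. f (1/2) p = 0}"
    and t: "0 \<le> t" "t \<le> 1"
  shows "ci {p. f x p \<ge> 0} \<in> Jn" "interior B \<subseteq> ci {p. f x p \<ge> 0}" "negligible (ci {p. f x p \<ge> 0} - A)"
    "measure lebesgue (ci {p. f x p \<ge> 0}) = t * measure lebesgue A + (1 - t) * measure lebesgue B"
proof -
  define S where "S = {p. f x p \<ge> 0}"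
  note S = closed_superlevel[of x, folded S_def] bounded_superlevel[of x, folded S_def] superlevel_lmeasurable[of x, folded S_def]
  have BA: "measure lebesgue B \<le> measure lebesgue A" using facts B by (intro measure_mono_fmeasurable) auto
  have tB: "measure lebesgue B \<le> measure lebesgue S" and tA: "measure lebesgue S \<le> measure lebesgue A"
    using convex_bound_le[of "measure lebesgue A" "measure lebesgue A" "measure lebesgue B" t "1 - t"] BA t
      mult_left_mono[OF BA t(1)]
    unfolding S_def h by (auto simp: algebra_simps)
  \<comment> \<open>Nothing prevents the chosen \<open>x\<close> from lying outside \<open>[0,1]\<close>; then the superlevel set contains \<open>A\<close>
    or is contained in \<open>B\<close>, and the measure forces equality up to a null set.\<close>
  have "\<exists>G F. open G \<and> G \<subseteq> S \<and> S \<subseteq> F \<and> closed F \<and> bounded F \<and> negligible (F - G) \<and> interior B \<subseteq> G \<and> negligible (F - A)"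
  proof -
    consider "0 \<le> x" "x \<le> 1" | "x > 1" | "x < 0" by linarith
    then show ?thesis
    proof cases
      case 1
      have "open {p. f x p > 0}" using continuous_f by (intro open_Collect_less) (auto intro: continuous_intros)
      moreover have "S - {p. f x p > 0} \<subseteq> {p. f x p = 0}" by (auto simp: S_def)
      moreover have "interior B \<subseteq> {p. f x p > 0}"
      proof
        fix p assume "p \<in> interior B"
        then have "dS p B > 0" using signs by blast
        moreover have "f x p \<ge> dS p B" unfolding f_alt(1) using 1 dS_le[of p] by simp
        ultimately show "p \<in> {p. f x p > 0}" by simp
      qed
      moreover have "S - A \<subseteq> frontier A"
        using superlevel_between(2)[OF 1] interior_subset[of A] by (auto simp: S_def frontier_def)
      ultimately show ?thesis
        using S A negligible_zero_set[OF 1 z]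
        by (intro exI[of _ "{p. f x p > 0}"] exI[of _ S]) (auto simp: S_def intro: negligible_subset)
    next
      case 2
      have AS: "A \<subseteq> S" using superlevel_ge_1[of x] 2 by (simp add: S_def)
      then have "measure lebesgue (S - A) = measure lebesgue S - measure lebesgue A"
        using S facts by (simp add: measurable_measure_Diff fmeasurableD)
      then have "negligible (S - A)"
        using tA S facts measure_nonneg[of lebesgue "S - A"] by (simp add: negligible_iff_measure fmeasurable_Diff)
      moreover have "S - interior A \<subseteq> (S - A) \<union> frontier A"
        using closure_subset by (auto simp: frontier_def)
      ultimately show ?thesis
        using S A AS interior_subset interior_mono[OF B(3)]
        by (intro exI[of _ "interior A"] exI[of _ S])
          (auto intro: negligible_subset[OF negligible_Un])
    next
      case 3
      have SB: "S \<subseteq> B" using superlevel_le_0[of x] 3 by (simp add: S_def)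
      then have "measure lebesgue (B - S) = measure lebesgue B - measure lebesgue S"
        using S facts by (simp add: measurable_measure_Diff fmeasurableD)
      then have "negligible (B - S)"
        using tB S facts measure_nonneg[of lebesgue "B - S"] by (simp add: negligible_iff_measure fmeasurable_Diff)
      \<comment> \<open>An open null set is empty, so \<open>interior B \<subseteq> S\<close>, and B
        with its interior is the sandwich.\<close>
      then have "negligible (interior B - S)" using interior_subset by (meson Diff_mono negligible_subset order_refl)
      moreover have "open (interior B - S)" using S by (simp add: open_Diff)
      ultimately have "interior B - S = {}" using open_not_negligible by blast
      then show ?thesis
        using SB B facts frontier_def
        by (intro exI[of _ "interior B"] exI[of _ B])
          (auto simp: frontier_def Diff_eq_empty_iff[THEN iffD2] closure_closed)
    qed
  qed
  then obtain G F where GF: "open G" "G \<subseteq> S" "S \<subseteq> F" "closed F" "bounded F" "negligible (F - G)"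
    "interior B \<subseteq> G" "negligible (F - A)" by blast
  note * = ci_in_Jn[OF GF(1-6)]
  show "ci {p. f x p \<ge> 0} \<in> Jn" using * by (simp add: S_def)
  show "interior B \<subseteq> ci {p. f x p \<ge> 0}" using * GF by (auto simp: S_def)
  show "negligible (ci {p. f x p \<ge> 0} - A)"
    using * GF(8) by (auto simp: S_def intro: negligible_subset)
  have "measure lebesgue (ci S) = measure lebesgue S"
    using * GF S by (intro measure_eq_sandwich[of G _ F]) auto
  then show "measure lebesgue (ci {p. f x p \<ge> 0}) = t * measure lebesgue A + (1 - t) * measure lebesgue B"
    using h by (simp add: S_def)
qed

end

section \<open>Step 1 of the measure average\<close>

text \<open>A may fail to be closed, so the maximum of \<open>dS\<close> is taken over the compact
  closure. It is positive, hence attained in the interior of A, and the choice in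
  \<open>dcenter\<close> is not vacuous.\<close>

lemma dcenter_in_interior:
  fixes A :: "'a::euclidean_space set"
  assumes A: "bounded A" "interior A \<noteq> {}"
  shows "dcenter A \<in> interior A"
proof -
  have ne: "A \<noteq> {}" using A by auto
  obtain c where c: "c \<in> interior A" using A by auto
  have cA: "c \<in> A" using c interior_subset by blast
  have pos: "dS c A > 0" using c dS_pos_iff[OF A(1) ne] by blast
  have "compact (closure A)" using A by simp
  then have "\<exists>p0\<in>closure A. \<forall>p\<in>closure A. dS p A \<le> dS p0 A"
    using ne continuous_on_dS by (intro continuous_attains_sup) auto
  then obtain p0 where p0: "\<And>p. p \<in> closure A \<Longrightarrow> dS p A \<le> dS p0 A" by blast
  have "dS p0 A > 0" using p0[of c] cA closure_subset pos by force
  then have "p0 \<in> A \<and> (\<forall>p\<in>A. dS p A \<le> dS p0 A)"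
    using p0 closure_subset dS_pos_iff[OF A(1) ne] interior_subset by blast
  then have "\<forall>p\<in>A. dS p A \<le> dS (dcenter A) A"
    unfolding dcenter_def by (rule someI2) blast
  then have "dS (dcenter A) A > 0" using pos cA by force
  then show ?thesis using dS_pos_iff[OF A(1) ne] by blast
qed

text \<open>For r > 0 the level \<open>infdist p B = r\<close> is null, so the open and closed
  neighbourhoods differ by a null set. At r = 0 the level is B itself, and the sandwich is B with
  its interior instead.\<close>

lemma ci_Onb_Int:
  fixes A B :: "'a::euclidean_space set"
  assumes A: "bounded A" "negligible (frontier A)" and B: "B \<in> Jn" "B \<noteq> {}" "B \<subseteq> A" and "r \<ge> 0"
  shows "ci (Onb B r \<inter> A) \<in> Jn" "interior B \<subseteq> ci (Onb B r \<inter> A)" "negligible (ci (Onb B r \<inter> A) - A)"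
    "measure lebesgue (ci (Onb B r \<inter> A)) = measure lebesgue (Onb B r \<inter> A)"
proof -
  note BJ = JnD[OF B(1)]
  let ?S = "Onb B r \<inter> A"
  have clO: "closed (Onb B r)" unfolding Onb_def
    by (intro closed_Collect_le) (auto intro: continuous_intros)
  have "A \<in> lmeasurable" using A by (simp add: measurable_Jordan)
  then have S: "?S \<in> lmeasurable" using clO fmeasurable_Int_fmeasurable[of A lebesgue "Onb B r"] by (simp add: Int_commute borel_closed)
  have "\<exists>G F. open G \<and> G \<subseteq> ?S \<and> ?S \<subseteq> F \<and> closed F \<and> bounded F \<and> negligible (F - G) \<and> interior B \<subseteq> G \<and> negligible (F - A)"
  proof (cases "r = 0")
    case True
    have "infdist p B \<le> 0 \<longleftrightarrow> p \<in> B" for p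
      by (metis BJ(1) B(2) in_closed_iff_infdist_zero infdist_nonneg order_antisym order_refl)
    then have "Onb B r \<inter> A = B" using B True by (auto simp: Onb_def)
    then show ?thesis using BJ B interior_subset[of B]
      by - (rule exI[of _ "interior B"], rule exI[of _ B], auto simp: frontier_def closure_closed Diff_eq_empty_iff[THEN iffD2])
  next
    case False
    then have r: "r > 0" using \<open>r \<ge> 0\<close> by simp
    let ?G = "{p. infdist p B < r} \<inter> interior A" and ?F = "Onb B r \<inter> closure A"
    have "negligible {p \<in> closure A. infdist p B = r}"
      using A by (intro negligible_infdist_level BJ B r lmeasurable_compact) simp
    moreover have "?F - ?G \<subseteq> {p \<in> closure A. infdist p B = r} \<union> frontier A"
      by (auto simp: Onb_def frontier_def)
    ultimately have "negligible (?F - ?G)" using A by (meson negligible_Un negligible_subset)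
    moreover have "open ?G" by (intro open_Int open_Collect_less) (auto intro: continuous_intros)
    moreover have "interior B \<subseteq> ?G"
      using interior_mono[OF B(3)] interior_subset[of B] r by auto
    moreover have "?F - A \<subseteq> frontier A" using interior_subset by (auto simp: frontier_def)
    then have "negligible (?F - A)" using A negligible_subset by blast
    moreover have "bounded ?F" using A by (auto intro: bounded_subset[OF bounded_closure])
    moreover have "?G \<subseteq> ?S" "?S \<subseteq> ?F" using interior_subset closure_subset by (auto simp: Onb_def)
    ultimately show ?thesis using clO by (intro exI[of _ ?G] exI[of _ ?F]) auto
  qed
  then obtain G F where GF: "open G" "G \<subseteq> ?S" "?S \<subseteq> F" "closed F" "bounded F" "negligible (F - G)"
    "interior B \<subseteq> G" "negligible (F - A)" by blast
  note * = ci_in_Jn[OF GF(1-6)]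
  show "ci ?S \<in> Jn" using * by simp
  show "interior B \<subseteq> ci ?S" using * GF by auto
  show "negligible (ci ?S - A)" using * GF(8) by (auto intro: negligible_subset)
  show "measure lebesgue (ci ?S) = measure lebesgue ?S"
    using * GF S by (intro measure_eq_sandwich[of G _ F]) auto
qed

text \<open>The distance to B plays the part of \<open>\<phi>\<close>: on \<open>A - B\<close> it is
  positive, as B is closed, and at most the diameter of A, with null levels.\<close>

lemma measure_Onb_Int_surj:
  fixes A B :: "'a::euclidean_space set"
  assumes A: "bounded A" "A \<in> lmeasurable" and B: "closed B" "B \<noteq> {}" "B \<subseteq> A" "B \<in> lmeasurable" and t: "0 \<le> t" "t \<le> 1"
  shows "\<exists>r\<ge>0. measure lebesgue (Onb B r \<inter> A) = t * measure lebesgue A + (1 - t) * measure lebesgue B"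
proof -
  obtain b where b: "b \<in> B" using B by blast
  have D: "A - B \<in> lmeasurable" using A B by blast
  have "negligible {p \<in> A - B. infdist p B = c}" for c
  proof (cases "c > 0")
    case True
    then show ?thesis using D B negligible_infdist_level by blast
  next
    case False
    then have "{p \<in> A - B. infdist p B = c} = {}"
      using infdist_pos_not_in_closed[OF B(1,2)] by force
    then show ?thesis by (simp only: negligible_empty)
  qed
  moreover have "(\<lambda>p. infdist p B) \<in> borel_measurable borel"
    by (intro borel_measurable_continuous_onI continuous_intros)
  moreover have "infdist p B \<in> {0..diameter A}" if "p \<in> A - B" for p
    using that infdist_le[OF b, of p] diameter_bounded_bound[OF A(1), of p b] b B infdist_nonneg[of p B] by auto
  moreover have "diameter A \<ge> 0" using A by (simp add: diameter_ge_0)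
  ultimately obtain r where r: "r \<ge> 0"
    "measure lebesgue {p \<in> A - B. infdist p B \<le> r} = t * measure lebesgue (A - B)"
    using measure_sublevel_surj[OF D, of "\<lambda>p. infdist p B" 0 "diameter A" "t * measure lebesgue (A - B)"] t
    by (auto simp: mult_left_le_one_le)
  define E where "E = {p \<in> A - B. infdist p B \<le> r}"
  have "Onb B r \<inter> A = B \<union> E" using B r by (auto simp: Onb_def E_def)
  moreover have "E \<in> lmeasurable"
  proof -
    have "closed (Onb B r)" unfolding Onb_def by (intro closed_Collect_le) (auto intro: continuous_intros)
    then have "(A - B) \<inter> Onb B r \<in> lmeasurable" using D by (intro fmeasurable_Int_fmeasurable) (auto simp: borel_closed)
    then show ?thesis by (simp add: Onb_def Int_def E_def)
  qed
  moreover have "E - B = E" by (auto simp: E_def)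
  ultimately have "measure lebesgue (Onb B r \<inter> A) = measure lebesgue B + t * measure lebesgue (A - B)"
    using r(2) B measure_Un2[of B lebesgue E] by (simp add: E_def)
  also have "measure lebesgue (A - B) = measure lebesgue A - measure lebesgue B"
    using A B by (simp add: measurable_measure_Diff fmeasurableD)
  finally show ?thesis using r by (auto simp: algebra_simps)
qed

text \<open>Under the zero-measure condition some parameter in [0,1], hence in [-N, N] as N \<ge> 1,
  realises the target measure; so the infimum is 0 and every minimiser is exact. Otherwise the
  neighbourhoods of B realise it.\<close>

lemma mavg_step1_between:
  fixes A B :: "'a::euclidean_space set"
  assumes regA: "bounded A" "negligible (frontier A)" "interior A \<noteq> {}"
    and regB: "B \<in> Jn" "B \<subseteq> A" "A \<noteq> B" and t: "0 \<le> t" "t \<le> 1" and N: "N \<ge> 1"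
  defines "M \<equiv> mavg_step1 N t A B"
  shows "M \<in> Jn" "negligible (B - M)" "negligible (M - A)"
    "measure lebesgue M = t * measure lebesgue A + (1 - t) * measure lebesgue B"
proof -
  note BJ = JnD[OF regB(1)]
  define \<tau> where "\<tau> = t * measure lebesgue A + (1 - t) * measure lebesgue B"
  \<comment> \<open>The convention for \<open>B = {}\<close> amounts to replacing \<open>B\<close> by the null set \<open>{q}\<close>, as
    \<open>dS p {q} = - norm (p - q)\<close>.\<close>
  define B' where "B' = (if B = {} then {dcenter A} else B)"
  have q: "dcenter A \<in> interior A" using dcenter_in_interior regA by blast
  then have qA: "dcenter A \<in> A" using interior_subset by blast
  interpret nested_pair A B'
  proof
    have "frontier {dcenter A} = {dcenter A}" by (simp add: frontier_def interior_singleton)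
    then show "negligible (frontier B')" using BJ by (auto simp: B'_def)
    show "closed B'" "B' \<noteq> {}" "B' \<subseteq> A" using BJ regB qA by (auto simp: B'_def)
  qed (use regA in auto)
  have mB: "measure lebesgue B' = measure lebesgue B" by (simp add: B'_def)
  have iB: "interior B = interior B'" by (simp add: B'_def)
  have davg_fun: "davg_fun x A B = f x" for x
    unfolding f_def davg_fun_def fun_eq_iff using facts(1) by (auto simp: B'_def dS_singleton algebra_simps)
  have davg: "davg x A B = {p. f x p \<ge> 0}" for x using facts(1) by (simp add: davg_def davg_fun)
  have zmc: "zero_measure_cond A B \<longleftrightarrow> negligible {p. f (1/2) p = 0}"
    by (simp add: zero_measure_cond_def davg_fun negligible_iff_null_sets)
  have "M \<in> Jn \<and> interior B \<subseteq> M \<and> negligible (M - A) \<and> measure lebesgue M = \<tau>"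
  proof (cases "zero_measure_cond A B")
    case True
    have z: "negligible {p \<in> interior A - B'. f (1/2) p = 0}"
      using True unfolding zmc by (rule negligible_subset) auto
    let ?P = "\<lambda>g. g \<in> {-N..N} \<and> \<bar>hAB A B g - \<tau>\<bar> = (INF \<xi>\<in>{-N..N}. \<bar>hAB A B \<xi> - \<tau>\<bar>)"
    obtain x where x: "x \<in> {0..1}" "hAB A B x = \<tau>"
      using measure_superlevel_surj[OF z t] by (auto simp: hAB_def davg mB \<tau>_def)
    have xN: "x \<in> {-N..N}" using x N by auto
    have "(INF \<xi>\<in>{-N..N}. \<bar>hAB A B \<xi> - \<tau>\<bar>) \<le> \<bar>hAB A B x - \<tau>\<bar>"
      using xN by (intro cINF_lower bdd_belowI[of _ 0]) auto
    moreover have "0 \<le> (INF \<xi>\<in>{-N..N}. \<bar>hAB A B \<xi> - \<tau>\<bar>)" using xN by (intro cINF_greatest) auto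
    ultimately have inf0: "(INF \<xi>\<in>{-N..N}. \<bar>hAB A B \<xi> - \<tau>\<bar>) = 0" using x by simp
    define g where "g = (SOME g. ?P g)"
    have "?P x" using xN x inf0 by simp
    then have "?P g" unfolding g_def by (rule someI)
    then have "hAB A B g = \<tau>" using inf0 by simp
    then have h: "measure lebesgue {p. f g p \<ge> 0} = t * measure lebesgue A + (1 - t) * measure lebesgue B'"
      by (simp add: hAB_def davg mB \<tau>_def)
    have "M = ci {p. f g p \<ge> 0}"
      using True regB(3) by (simp add: M_def mavg_step1_def Let_def \<tau>_def[symmetric] g_def davg)
    then show ?thesis using ci_superlevel[OF h z t] iB mB by (simp add: \<tau>_def)
  next
    case False
    \<comment> \<open>For empty B the level 1/2 within \<open>interior A - B'\<close> consists of
      points equidistant from the frontier and from \<open>dcenter A\<close>, a null set; so the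
      condition could not have failed.\<close>
    have ne: "B \<noteq> {}"
    proof
      assume "B = {}"
      then have B': "B' = {dcenter A}" by (simp add: B'_def)
      have "dS p A = infdist p (frontier A)" if "p \<in> interior A" for p
        using that interior_subset by (auto simp: dS_def)
      then have "{p \<in> interior A - B'. f (1/2) p = 0} = {p \<in> interior A - {dcenter A}. infdist p (frontier A) = dist p (dcenter A)}"
        unfolding f_def by (auto simp: B' dS_singleton dist_norm)
      then have "negligible {p \<in> interior A - B'. f (1/2) p = 0}"
        using negligible_equidistant_interior_point[OF regA(1) q] facts(5) B' by simp
      then have "negligible {p. f (1/2) p = 0}" by (intro negligible_zero_set) auto
      then show False using False zmc by simp
    qed
    define r where "r = (SOME r. r \<ge> 0 \<and> measure lebesgue (Onb B r \<inter> A) = \<tau>)"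
    have "\<exists>r. r \<ge> 0 \<and> measure lebesgue (Onb B r \<inter> A) = \<tau>"
      using measure_Onb_Int_surj[OF regA(1) facts(3) BJ(1) ne regB(2) BJ(4) t] by (auto simp: \<tau>_def)
    then have r: "r \<ge> 0 \<and> measure lebesgue (Onb B r \<inter> A) = \<tau>" unfolding r_def by (rule someI_ex)
    have "M = ci (Onb B r \<inter> A)"
      using False regB(3) t by (simp add: M_def mavg_step1_def Let_def \<tau>_def[symmetric] r_def[symmetric])
    then show ?thesis using ci_Onb_Int[OF regA(1,2) regB(1) ne regB(2), of r] r by simp
  qed
  moreover have "B - M \<subseteq> frontier B" if "interior B \<subseteq> M"
    using that closure_subset by (auto simp: frontier_def)
  ultimately show "M \<in> Jn" "negligible (B - M)" "negligible (M - A)"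
    "measure lebesgue M = t * measure lebesgue A + (1 - t) * measure lebesgue B"
    using BJ(3) negligible_subset by (auto simp: \<tau>_def)
qed

section \<open>The measure average\<close>

lemma Un_in_Jn:
  assumes "A \<in> Jn" "B \<in> Jn" shows "A \<union> B \<in> Jn"
proof -
  note A = JnD[OF assms(1)] and B = JnD[OF assms(2)]
  have "negligible (frontier (A \<union> B))"
    using A B frontier_Un_subset by (meson negligible_Un negligible_subset)
  moreover have "ci (A \<union> B) = A \<union> B"
  proof
    show "ci (A \<union> B) \<subseteq> A \<union> B" unfolding ci_def
      using A B by (intro closure_minimal interior_subset) auto
    have "closure (interior A) \<union> closure (interior B) \<subseteq> ci (A \<union> B)"
      unfolding ci_def by (intro Un_least closure_mono interior_mono) auto
    then show "A \<union> B \<subseteq> ci (A \<union> B)" using A B by simp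
  qed
  ultimately show ?thesis using A B by (auto simp: Jn_def negligible_iff_null_sets)
qed

lemma Union_in_Jn: "finite P \<Longrightarrow> (\<And>X. X \<in> P \<Longrightarrow> R X \<in> Jn) \<Longrightarrow> \<Union>(R ` P) \<in> Jn"
proof (induction P rule: finite_induct)
  case empty
  then show ?case by (simp add: Jn_def ci_def)
qed (simp add: Un_in_Jn)

lemma measure_Diff_negligible:
  assumes "X \<in> lmeasurable" "Y \<in> lmeasurable" "negligible (Y - X)"
  shows "measure lebesgue (X - Y) = measure lebesgue X - measure lebesgue Y"
proof -
  have "measure lebesgue X = measure lebesgue (X \<union> Y)"
    using assms by (intro measure_negligible_symdiff) (auto intro: negligible_subset[OF assms(3)])
  also have "\<dots> = measure lebesgue Y + measure lebesgue (X - Y)"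
    using assms by (subst Un_commute) (rule measure_Un2)
  finally show ?thesis by simp
qed

section \<open>Components of A - B and Step 2 of the measure average\<close>

text \<open>A point of \<open>interior A\<close> off B has a ball inside \<open>A - B\<close>. The
  ball is connected and so lies in a single component, which belongs to the family or is disjoint
  from its union.\<close>

lemma frontier_Un_components_subset:
  fixes A B :: "'a::euclidean_space set"
  assumes "closed A" "closed B" "B \<subseteq> A" "\<C> \<subseteq> components (A - B)"
  shows "frontier (B \<union> \<Union>\<C>) \<subseteq> frontier A \<union> frontier B"
proof
  fix p assume p: "p \<in> frontier (B \<union> \<Union>\<C>)"
  have sub: "B \<union> \<Union>\<C> \<subseteq> A" using assms in_components_subset by blast
  then have pA: "p \<in> A" using p closure_minimal[OF sub assms(1)] by (auto simp: frontier_def)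
  show "p \<in> frontier A \<union> frontier B"
  proof (rule ccontr)
    assume "p \<notin> frontier A \<union> frontier B"
    then have int: "p \<in> interior A" and "p \<notin> frontier B" using pA assms by (auto simp: frontier_def)
    moreover have "p \<notin> interior B" using p interior_mono[of B "B \<union> \<Union>\<C>"] by (auto simp: frontier_def)
    ultimately have "p \<notin> B" using assms by (auto simp: frontier_def)
    then have "p \<in> interior A - B" "open (interior A - B)" using int assms by auto
    then obtain e where e: "e > 0" "ball p e \<subseteq> interior A - B" by (meson openE)
    then have bD: "ball p e \<subseteq> A - B" using interior_subset by blast
    have "p \<in> closure (B \<union> \<Union>\<C>)" using p by (auto simp: frontier_def)
    then obtain z where z: "z \<in> B \<union> \<Union>\<C>" "dist z p < e" using e closure_approachable by blast
    then have zb: "z \<in> ball p e" by (simp add: dist_commute)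
    then obtain C where C: "C \<in> \<C>" "z \<in> C" using z e by auto
    have "ball p e \<subseteq> C"
      using C assms zb bD by (intro components_maximal[of C "A - B"]) auto
    then have "ball p e \<subseteq> B \<union> \<Union>\<C>" using C by blast
    then have "p \<in> interior (B \<union> \<Union>\<C>)" using e by (meson centre_in_ball interior_maximal open_ball subsetD)
    then show False using p by (simp add: frontier_def)
  qed
qed

text \<open>Components are closed in \<open>A - B\<close>, so removing finitely many leaves a
  relatively open set, and the density of \<open>interior A\<close> in A gives it an interior point.
  This point is what \<open>dcenter\<close> needs when B is empty.\<close>

lemma interior_Union_components_nonempty:
  fixes A B :: "'a::euclidean_space set"
  assumes A: "A \<subseteq> closure (interior A)" and B: "closed B" and sub: "\<C> \<subseteq> components (A - B)"
    and fin: "finite (components (A - B) - \<C>)" and ne: "\<Union>\<C> \<noteq> {}"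
  shows "interior (\<Union>\<C>) \<noteq> {}"
proof -
  let ?D = "A - B"
  have "\<Union>\<C> = ?D - \<Union>(components ?D - \<C>)"
  proof -
    have "x \<notin> C'" if "x \<in> C" "C \<in> \<C>" "C' \<in> components ?D - \<C>" for x C C'
      using that sub components_nonoverlap[of C ?D C'] by blast
    moreover have "\<Union>\<C> \<subseteq> ?D" using sub Union_components[of ?D] by blast
    moreover have "?D \<subseteq> \<Union>(components ?D - \<C>) \<union> \<Union>\<C>" using Union_components[of ?D] by blast
    ultimately show ?thesis by blast
  qed
  moreover have "closedin (top_of_set ?D) (\<Union>(components ?D - \<C>))"
    using fin closedin_component by (intro closedin_Union) auto
  ultimately have "openin (top_of_set ?D) (\<Union>\<C>)"
    by (metis openin_diff openin_subtopology_self)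
  then obtain W where W: "open W" "\<Union>\<C> = ?D \<inter> W" by (auto simp: openin_open)
  have "open (W - B)" using W B by (simp add: open_Diff)
  moreover have "(W - B) \<inter> closure (interior A) \<noteq> {}" using W ne A by auto
  ultimately have "(W - B) \<inter> interior A \<noteq> {}" using open_Int_closure_eq_empty by blast
  moreover have "(W - B) \<inter> interior A \<subseteq> interior (\<Union>\<C>)"
    using \<open>open (W - B)\<close> interior_subset[of A] W by (intro interior_maximal open_Int) auto
  ultimately show ?thesis by blast
qed

lemma step2_comps_partition:
  fixes A B :: "'a::euclidean_space set"
  assumes A: "A \<in> Jn" and B: "B \<in> Jn" "B \<subseteq> A" and "\<epsilon> > 0"
  defines "P \<equiv> step2_comps \<epsilon> A B"
  shows "finite P" "pairwise disjnt P" "\<Union>P = A - B"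
    "\<And>C. C \<in> P \<Longrightarrow> C \<subseteq> A - B \<and> negligible (frontier (B \<union> C)) \<and> interior C \<noteq> {}"
proof -
  note AJ = JnD[OF A] and BJ = JnD[OF B(1)]
  define K where "K = components (A - B)"
  have fr: "negligible (frontier (B \<union> \<Union>\<C>))" if "\<C> \<subseteq> K" for \<C>
    using frontier_Un_components_subset[of A B \<C>] that AJ BJ B
    by (auto simp: K_def intro: negligible_subset[OF negligible_Un])
  \<comment> \<open>The family is not known to be countable; measurability comes from the null
    frontier of \<open>B \<union> \<Union>\<C>\<close>.\<close>
  have un_lm: "\<Union>\<C> \<in> lmeasurable" if "\<C> \<subseteq> K" for \<C>
  proof -
    have "\<Union>\<C> \<subseteq> A - B" using Union_mono[OF that] by (simp add: K_def)
    then have "\<Union>\<C> = (B \<union> \<Union>\<C>) - B" "B \<union> \<Union>\<C> \<subseteq> A" using B by blast+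
    moreover have "bounded (B \<union> \<Union>\<C>)" using calculation(2) AJ(2) bounded_subset by blast
    moreover have "B \<union> \<Union>\<C> \<in> lmeasurable" using fr[OF that] calculation(3) by (simp add: measurable_Jordan)
    ultimately show ?thesis using BJ(4) by (metis fmeasurable_Diff fmeasurableD)
  qed
  have lm: "C \<in> lmeasurable" if "C \<in> K" for C using un_lm[of "{C}"] that by simp
  have Kdisj: "pairwise disjnt K"
    using pairwise_disjoint_components[of "A - B"] by (simp add: K_def pairwise_def disjnt_def)
  define Big where "Big = {C \<in> K. measure lebesgue C \<ge> \<epsilon>}"
  define Small where "Small = {C \<in> K. measure lebesgue C < \<epsilon>}"
  \<comment> \<open>Disjoint subsets of A of measure at least \<epsilon> number at most the measure
    of A divided by \<epsilon>.\<close>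
  have finBig: "finite Big"
  proof (rule finite_if_finite_subsets_card_bdd[THEN conjunct1])
    fix G assume G: "G \<subseteq> Big" "finite G"
    have "real (card G) * \<epsilon> = (\<Sum>C\<in>G. \<epsilon>)" by simp
    also have "\<dots> \<le> (\<Sum>C\<in>G. measure lebesgue C)" using G by (intro sum_mono) (auto simp: Big_def)
    also have "\<dots> = measure lebesgue (\<Union>G)"
      using G lm Kdisj by (intro measure_Union'[symmetric]) (auto simp: Big_def intro: pairwise_subset)
    also have "\<dots> \<le> measure lebesgue A"
    proof (intro measure_mono_fmeasurable)
      have "G \<subseteq> K" using G by (auto simp: Big_def)
      then show "\<Union>G \<subseteq> A" "\<Union>G \<in> sets lebesgue"
        using Union_mono[of G K] un_lm[of G] by (auto simp: K_def)
    qed (use AJ in auto)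
    finally have "real (card G) \<le> measure lebesgue A / \<epsilon>" using \<open>\<epsilon> > 0\<close> by (simp add: field_simps)
    then show "card G \<le> nat \<lfloor>measure lebesgue A / \<epsilon>\<rfloor>" by (simp add: le_nat_floor)
  qed
  have P: "P = (if finite K then K else Big \<union> (if \<Union>Small = {} then {} else {\<Union>Small}))"
    unfolding P_def step2_comps_def K_def Big_def Small_def Let_def by (rule refl)
  have BS: "K = Big \<union> Small" "Big \<inter> Small = {}" by (auto simp: Big_def Small_def)
  show "finite P" unfolding P using finBig by auto
  show "\<Union>P = A - B"
  proof -
    have "\<Union>P = \<Union>K" unfolding P using BS by (cases "finite K") auto
    then show ?thesis by (simp add: K_def)
  qed
  have "disjnt C S" if "C \<in> Big" "S \<in> Small" for C S
  proof -
    have "C \<noteq> S" "C \<in> K" "S \<in> K" using that BS by blast+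
    then show ?thesis using pairwiseD[OF Kdisj] by blast
  qed
  then have "disjnt C (\<Union>Small)" "disjnt (\<Union>Small) C" if "C \<in> Big" for C
    using that by (auto simp: disjnt_def)
  moreover have "pairwise disjnt Big" using Kdisj BS pairwise_subset by blast
  ultimately show "pairwise disjnt P" unfolding P using Kdisj by (auto simp: pairwise_insert)
  fix C assume C: "C \<in> P"
  have sub: "C \<subseteq> A - B" using C \<open>\<Union>P = A - B\<close> by blast
  obtain \<C> where CC: "\<C> \<subseteq> K" "C = \<Union>\<C>"
  proof (cases "C \<in> K")
    case True then show ?thesis using that[of "{C}"] by simp
  next
    case False
    then have "C = \<Union>Small" using C BS unfolding P by (auto split: if_splits)
    then show ?thesis using that[of Small] BS by blast
  qed
  have "interior C \<noteq> {}"
  proof -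
    consider "C \<in> K" "finite K" | "C \<in> Big" | "C = \<Union>Small" "C \<noteq> {}"
      using C unfolding P by (auto split: if_splits)
    then show ?thesis
    proof cases
      case 1
      then have "C \<noteq> {}" using in_components_nonempty by (auto simp: K_def)
      then show ?thesis
        using 1 interior_Union_components_nonempty[of A B "{C}"] AJ BJ by (simp add: K_def)
    next
      \<comment> \<open>\<open>Small\<close> arises by removing the finitely many members of
        \<open>Big\<close>, so its union is relatively open.\<close>
      case 3
      then show ?thesis
        using interior_Union_components_nonempty[of A B Small] AJ BJ finBig BS
        by (auto simp: K_def[symmetric] intro: finite_subset)
    next
      case 2
      \<comment> \<open>With infinitely many components, \<open>C\<close> need not be open in \<open>A - B\<close>; its positive measure is what helps.\<close>
      show ?thesis
      proof
        assume i: "interior C = {}"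
        have "C \<subseteq> frontier (B \<union> C) \<union> frontier B"
        proof
          fix x assume x: "x \<in> C"
          then have xB: "x \<notin> B" using sub by blast
          have "x \<notin> interior (B \<union> C)"
          proof
            assume "x \<in> interior (B \<union> C)"
            then have "x \<in> interior (B \<union> C) - B" using xB by blast
            moreover have "open (interior (B \<union> C) - B)" using BJ by (simp add: open_Diff)
            moreover have "interior (B \<union> C) - B \<subseteq> C" using interior_subset by blast
            ultimately have "x \<in> interior C" by (meson interior_maximal subsetD)
            then show False using i by simp
          qed
          then show "x \<in> frontier (B \<union> C) \<union> frontier B"
            using x closure_subset[of "B \<union> C"] by (auto simp: frontier_def)
        qed
        moreover have "negligible (frontier (B \<union> C))" using fr[OF CC(1)] CC by simp
        ultimately have "negligible C" using BJ by (meson negligible_Un negligible_subset)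
        then have "measure lebesgue C = 0" by (rule negligible_imp_measure0)
        then show False using 2 \<open>\<epsilon> > 0\<close> by (simp add: Big_def)
      qed
    qed
  qed
  then show "C \<subseteq> A - B \<and> negligible (frontier (B \<union> C)) \<and> interior C \<noteq> {}"
    using sub fr[OF CC(1)] CC by simp
qed

text \<open>Up to null sets each \<open>R C\<close> is B together with a part \<open>E C\<close> of
  C that has t times the measure of C. These parts are disjoint and finitely many, so their measures
  add up and the null errors stay null.\<close>

lemma mavg_step2_between:
  fixes A B :: "'a::euclidean_space set"
  assumes A: "A \<in> Jn" and B: "B \<in> Jn" "B \<subseteq> A" and t: "0 \<le> t" "t \<le> 1" and N: "N \<ge> 1" and "\<epsilon> > 0"
  defines "M \<equiv> mavg_step2 N \<epsilon> t A B"
  shows "M \<in> Jn" "negligible (B - M)" "negligible (M - A)"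
    "measure lebesgue M = t * measure lebesgue A + (1 - t) * measure lebesgue B"
proof -
  note AJ = JnD[OF A] and BJ = JnD[OF B(1)]
  have "M \<in> Jn \<and> negligible (B - M) \<and> negligible (M - A) \<and>
    measure lebesgue M = t * measure lebesgue A + (1 - t) * measure lebesgue B"
  proof (cases "A = B")
    case True
    then have "M = A" by (simp add: M_def mavg_step2_def)
    then show ?thesis using True A by (simp add: algebra_simps)
  next
    case False
    define P where "P = step2_comps \<epsilon> A B"
    note P = step2_comps_partition[OF A B \<open>\<epsilon> > 0\<close>, folded P_def]
    define R where "R C = mavg_step1 N t (B \<union> C) B" for C
    have M: "M = \<Union>(R ` P)" using False t by (simp add: M_def mavg_step2_def R_def P_def)
    have R: "R C \<in> Jn \<and> negligible (B - R C) \<and> negligible (R C - (B \<union> C)) \<and>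
        measure lebesgue (R C) = t * measure lebesgue (B \<union> C) + (1 - t) * measure lebesgue B"
      if "C \<in> P" for C
    proof -
      have "bounded (B \<union> C)" using P(4)[OF that] AJ B by (meson Diff_subset Un_least bounded_subset subset_trans)
      moreover have "interior (B \<union> C) \<noteq> {}" using P(4)[OF that] interior_mono[of C "B \<union> C"] by auto
      moreover have "C \<noteq> {}" using P(4)[OF that] by auto
      then have "B \<union> C \<noteq> B" using P(4)[OF that] by blast
      ultimately show ?thesis
        unfolding R_def using P(4)[OF that] B(1) t N by (intro conjI mavg_step1_between) auto
    qed
    have MJ: "M \<in> Jn" unfolding M using P(1) R by (intro Union_in_Jn) auto
    have "P \<noteq> {}" using P(3) False B by auto
    then obtain C0 where C0: "C0 \<in> P" by blast
    have nB: "negligible (B - M)"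
      using R[OF C0] C0 by (auto simp: M intro: negligible_subset[of "B - R C0"])
    define Q where "Q = (\<Union>C\<in>P. R C - (B \<union> C))"
    have Q: "negligible Q" unfolding Q_def using P(1) R by (intro negligible_Union) auto
    have nA: "negligible (M - A)"
      using P(4) B by (intro negligible_subset[OF Q]) (auto simp: M Q_def)
    define E where "E C = R C \<inter> C" for C
    have Clm: "C \<in> lmeasurable" "B \<union> C \<in> lmeasurable" if "C \<in> P" for C
    proof -
      have "bounded (B \<union> C)" using P(4)[OF that] AJ B by (meson Diff_subset Un_least bounded_subset subset_trans)
      then show "B \<union> C \<in> lmeasurable" using P(4)[OF that] by (simp add: measurable_Jordan)
      moreover have "C = (B \<union> C) - B" using P(4)[OF that] by blast
      ultimately show "C \<in> lmeasurable" using BJ(4) by (metis fmeasurable_Diff fmeasurableD)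
    qed
    have Elm: "E C \<in> lmeasurable" if "C \<in> P" for C
      using Clm[OF that] R[OF that] JnD(4) by (auto simp: E_def)
    have mE: "measure lebesgue (E C) = t * measure lebesgue C" if C: "C \<in> P" for C
    proof -
      have disj: "C - B = C" "E C - B = E C" using P(4)[OF C] by (auto simp: E_def)
      have "measure lebesgue (B \<union> E C) = measure lebesgue (R C)"
      proof (rule measure_negligible_symdiff)
        show "R C \<in> lmeasurable" using R[OF C] JnD(4) by blast
        have "negligible ((B - R C) \<union> (R C - (B \<union> C)))" using R[OF C] by (simp add: negligible_Un)
        then show "negligible ((R C - (B \<union> E C)) \<union> ((B \<union> E C) - R C))"
          by (rule negligible_subset) (auto simp: E_def)
      qed
      moreover have "measure lebesgue (B \<union> E C) = measure lebesgue B + measure lebesgue (E C)"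
        using measure_Un2[OF BJ(4) Elm[OF C]] disj by simp
      moreover have "measure lebesgue (B \<union> C) = measure lebesgue B + measure lebesgue C"
        using measure_Un2[OF BJ(4) Clm(1)[OF C]] disj by simp
      ultimately show ?thesis using R[OF C] by (simp add: algebra_simps)
    qed
    have disjE: "pairwise (\<lambda>C C'. disjnt (E C) (E C')) P"
      using P(2) by (auto simp: pairwise_def disjnt_def E_def)
    have UE: "(\<Union>C\<in>P. E C) \<in> lmeasurable" using P(1) Elm by (intro fmeasurable.finite_UN) auto
    have "measure lebesgue (B \<union> (\<Union>C\<in>P. E C)) = measure lebesgue M"
    proof (rule measure_negligible_symdiff)
      show "M \<in> lmeasurable" using MJ JnD by blast
      have "M - (B \<union> (\<Union>C\<in>P. E C)) \<union> ((B \<union> (\<Union>C\<in>P. E C)) - M) \<subseteq> (B - M) \<union> Q"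
        by (auto simp: M Q_def E_def)
      then show "negligible (M - (B \<union> (\<Union>C\<in>P. E C)) \<union> ((B \<union> (\<Union>C\<in>P. E C)) - M))"
        using nB Q by (meson negligible_Un negligible_subset)
    qed
    moreover have "(\<Union>C\<in>P. E C) - B = (\<Union>C\<in>P. E C)" using P(4) by (auto simp: E_def)
    then have "measure lebesgue (B \<union> (\<Union>C\<in>P. E C)) = measure lebesgue B + measure lebesgue (\<Union>C\<in>P. E C)"
      using measure_Un2[OF BJ(4) UE] by simp
    moreover have "measure lebesgue (\<Union>C\<in>P. E C) = (\<Sum>C\<in>P. t * measure lebesgue C)"
      using P(1) Elm disjE mE by (subst measure_UNION') auto
    moreover have "(\<Sum>C\<in>P. t * measure lebesgue C) = t * measure lebesgue (\<Union>P)"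
      using P(1,2) Clm by (subst measure_Union') (auto simp: sum_distrib_left)
    moreover have "measure lebesgue (\<Union>P) = measure lebesgue A - measure lebesgue B"
      using P(3) measure_Diff_negligible[OF AJ(4) BJ(4)] B(2) by (simp add: Diff_eq_empty_iff[THEN iffD2])
    ultimately show ?thesis using MJ nA nB by (simp add: algebra_simps)
  qed
  then show "M \<in> Jn" "negligible (B - M)" "negligible (M - A)"
    "measure lebesgue M = t * measure lebesgue A + (1 - t) * measure lebesgue B" by auto
qed

section \<open>The symmetric-difference distance and the metric property of the average\<close>

lemma dmu_commute: "dmu A B = dmu B A"
  by (simp add: dmu_def Un_commute)

lemma dmu_nonneg: "dmu A B \<ge> 0"
  by (simp add: dmu_def)

lemma dmu_self [simp]: "dmu A A = 0"
  by (simp add: dmu_def)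

lemma dmu_triangle:
  fixes A B C :: "'a::euclidean_space set"
  assumes "A \<in> lmeasurable" "B \<in> lmeasurable" "C \<in> lmeasurable"
  shows "dmu A C \<le> dmu A B + dmu B C"
proof -
  let ?D = "\<lambda>X Y. (X - Y) \<union> (Y - X)"
  have lm: "?D X Y \<in> lmeasurable" if "X \<in> lmeasurable" "Y \<in> lmeasurable" for X Y :: "'a set"
    using that by (intro fmeasurable.Un fmeasurable_Diff fmeasurableD)
  have "measure lebesgue (?D A C) \<le> measure lebesgue (?D A B \<union> ?D B C)"
    using assms lm by (intro measure_mono_fmeasurable fmeasurable.Un fmeasurableD) auto
  also have "\<dots> \<le> measure lebesgue (?D A B) + measure lebesgue (?D B C)"
    using assms lm by (intro measure_Un_le fmeasurableD) auto
  finally show ?thesis by (simp add: dmu_def)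
qed

text \<open>Write M for the union. Up to null sets \<open>A - M\<close> is
  \<open>A - R\<^sub>1\<close> and \<open>M - A\<close> is \<open>R\<^sub>2 - I\<close>. By the
  prescribed measures these have 1 - t times the measure of \<open>A - I\<close> and
  \<open>B - I\<close>, which together make up the symmetric difference of A and B.\<close>

lemma dmu_average_of_parts:
  fixes A B :: "'a::euclidean_space set"
  assumes lm: "A \<in> lmeasurable" "B \<in> lmeasurable" "I \<in> lmeasurable" "R\<^sub>1 \<in> lmeasurable" "R\<^sub>2 \<in> lmeasurable"
    and I: "I \<subseteq> A \<inter> B" "negligible (A \<inter> B - I)"
    and R1: "negligible (I - R\<^sub>1)" "negligible (R\<^sub>1 - A)"
      "measure lebesgue R\<^sub>1 = t * measure lebesgue A + (1 - t) * measure lebesgue I"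
    and R2: "negligible (I - R\<^sub>2)" "negligible (R\<^sub>2 - B)"
      "measure lebesgue R\<^sub>2 = (1 - t) * measure lebesgue B + t * measure lebesgue I"
  shows "dmu A (R\<^sub>1 \<union> R\<^sub>2) = (1 - t) * dmu A B"
proof -
  define M where "M = R\<^sub>1 \<union> R\<^sub>2"
  have M: "M \<in> lmeasurable" using lm by (auto simp: M_def)
  have dis: "measure lebesgue ((X - Y) \<union> (Y - X)) = measure lebesgue (X - Y) + measure lebesgue (Y - X)"
    if "X \<in> lmeasurable" "Y \<in> lmeasurable" for X Y :: "'a set"
  proof -
    have "X - Y \<in> lmeasurable" "Y - X \<in> lmeasurable" "Y - X - (X - Y) = Y - X"
      using that by (auto intro: fmeasurable_Diff)
    then show ?thesis using measure_Un2[of "X - Y" lebesgue "Y - X"] by simp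
  qed
  have eq: "measure lebesgue X = measure lebesgue Y"
    if "Y \<in> lmeasurable" "Y - X \<subseteq> Z" "X - Y \<subseteq> Z" "negligible Z" for X Y Z :: "'a set"
    using that by (intro measure_negligible_symdiff negligible_subset[OF that(4)]) auto
  have "measure lebesgue (A - B) = measure lebesgue (A - I)"
    using lm I by (intro eq[of _ _ "A \<inter> B - I"] fmeasurable_Diff) auto
  then have AB: "measure lebesgue (A - B) = measure lebesgue A - measure lebesgue I"
    using measure_Diff_negligible[OF lm(1,3)] I by (simp add: Diff_eq_empty_iff[THEN iffD2])
  have "measure lebesgue (B - A) = measure lebesgue (B - I)"
    using lm I by (intro eq[of _ _ "A \<inter> B - I"] fmeasurable_Diff) auto
  then have BA: "measure lebesgue (B - A) = measure lebesgue B - measure lebesgue I"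
    using measure_Diff_negligible[OF lm(2,3)] I by (simp add: Diff_eq_empty_iff[THEN iffD2])
  \<comment> \<open>This set collects all discrepancies: a point of
    \<open>R\<^sub>2 \<inter> A\<close> outside \<open>R\<^sub>1\<close>, for instance, lies outside
    B, in \<open>A \<inter> B - I\<close> or in \<open>I - R\<^sub>1\<close>.\<close>
  have Z: "negligible ((R\<^sub>2 - B) \<union> (A \<inter> B - I) \<union> (I - R\<^sub>1) \<union> (R\<^sub>1 - A))"
    using I R1 R2 by (simp add: negligible_Un)
  have "measure lebesgue (A - M) = measure lebesgue (A - R\<^sub>1)"
    using lm by (intro eq[OF _ _ _ Z] fmeasurable_Diff) (auto simp: M_def)
  then have AM: "measure lebesgue (A - M) = measure lebesgue A - measure lebesgue R\<^sub>1"
    using measure_Diff_negligible[OF lm(1,4) R1(2)] by simp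
  have "measure lebesgue (M - A) = measure lebesgue (R\<^sub>2 - I)"
    using lm I by (intro eq[OF _ _ _ Z] fmeasurable_Diff) (auto simp: M_def)
  then have MA: "measure lebesgue (M - A) = measure lebesgue R\<^sub>2 - measure lebesgue I"
    using measure_Diff_negligible[OF lm(5,3) R2(1)] by simp
  show ?thesis
    unfolding dmu_def M_def[symmetric] dis[OF lm(1) M] dis[OF lm(1,2)] AB BA AM MA R1(3) R2(3)
    by (simp add: algebra_simps)
qed

lemma mavg_between:
  fixes A B :: "'a::euclidean_space set"
  assumes A: "A \<in> Jn" and B: "B \<in> Jn" and t: "0 \<le> t" "t \<le> 1" and N: "N \<ge> 1" and eps: "\<epsilon> > 0"
  shows "mavg N \<epsilon> t A B \<in> Jn" "dmu A (mavg N \<epsilon> t A B) = (1 - t) * dmu A B"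
    "dmu (mavg N \<epsilon> t A B) B = t * dmu A B"
proof -
  define M where "M = mavg N \<epsilon> t A B"
  have "M \<in> Jn \<and> dmu A M = (1 - t) * dmu A B \<and> dmu M B = t * dmu A B"
  proof (cases "A = B")
    case True
    then show ?thesis using A by (simp add: M_def mavg_def)
  next
    case False
    note AJ = JnD[OF A] and BJ = JnD[OF B]
    define I where "I = ci (A \<inter> B)"
    have fr: "negligible (A \<inter> B - interior (A \<inter> B))"
    proof (rule negligible_subset)
      show "negligible (frontier A \<union> frontier B)" using AJ BJ by (simp add: negligible_Un)
      show "A \<inter> B - interior (A \<inter> B) \<subseteq> frontier A \<union> frontier B"
        using AJ BJ by (auto simp: frontier_def interior_Int)
    qed
    have "closed (A \<inter> B)" "bounded (A \<inter> B)" using AJ BJ by (auto intro: bounded_subset)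
    then have I: "I \<in> Jn" "interior (A \<inter> B) \<subseteq> I" "I \<subseteq> A \<inter> B"
      unfolding I_def using ci_in_Jn[OF open_interior interior_subset order_refl _ _ fr] by blast+
    have nI: "negligible (A \<inter> B - I)" using I(2) by (intro negligible_subset[OF fr]) auto
    define R\<^sub>1 R\<^sub>2 where "R\<^sub>1 = mavg_step2 N \<epsilon> t A I" and "R\<^sub>2 = mavg_step2 N \<epsilon> (1 - t) B I"
    have t': "0 \<le> 1 - t" "1 - t \<le> 1" using t by auto
    have IA: "I \<subseteq> A" "I \<subseteq> B" using I by auto
    note R1 = mavg_step2_between[OF A I(1) IA(1) t N eps, folded R\<^sub>1_def]
    note R2 = mavg_step2_between[OF B I(1) IA(2) t' N eps, folded R\<^sub>2_def]
    have M: "M = R\<^sub>1 \<union> R\<^sub>2" using False t by (simp add: M_def mavg_def Let_def R\<^sub>1_def R\<^sub>2_def I_def)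
    have "M \<in> Jn" unfolding M using R1 R2 by (intro Un_in_Jn)
    moreover have "dmu A M = (1 - t) * dmu A B"
      unfolding M using R1 R2 JnD(4)[OF R1(1)] JnD(4)[OF R2(1)] JnD(4)[OF I(1)] AJ(4) BJ(4) I nI
      by (intro dmu_average_of_parts[where I = I]) auto
    \<comment> \<open>Exchanging A with B and t with 1 - t turns the same lemma into the other
      distance.\<close>
    moreover have "dmu B (R\<^sub>2 \<union> R\<^sub>1) = (1 - (1 - t)) * dmu B A"
      using R1 R2 JnD(4)[OF R1(1)] JnD(4)[OF R2(1)] JnD(4)[OF I(1)] AJ(4) BJ(4) I nI
      by (intro dmu_average_of_parts[where I = I]) (auto simp: Int_commute)
    then have "dmu M B = t * dmu A B" unfolding M by (simp add: dmu_commute Un_commute)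
    ultimately show ?thesis by blast
  qed
  then show "mavg N \<epsilon> t A B \<in> Jn" "dmu A (mavg N \<epsilon> t A B) = (1 - t) * dmu A B"
    "dmu (mavg N \<epsilon> t A B) B = t * dmu A B" by (auto simp: M_def)
qed

lemma dmu_Jn_triangle: "A \<in> Jn \<Longrightarrow> B \<in> Jn \<Longrightarrow> C \<in> Jn \<Longrightarrow> dmu A C \<le> dmu A B + dmu B C"
  using dmu_triangle JnD(4) by blast

lemma dmu_chain:
  fixes G :: "int \<Rightarrow> 'a::euclidean_space set"
  assumes J: "\<And>i. G i \<in> Jn" and d: "\<And>i. dmu (G i) (G (i + 1)) \<le> \<delta>"
  shows "dmu (G i) (G (i + int n)) \<le> real n * \<delta>"
proof (induction n)
  case (Suc n)
  have "dmu (G i) (G (i + int (Suc n))) \<le> dmu (G i) (G (i + int n)) + dmu (G (i + int n)) (G (i + int n + 1))"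
    using dmu_Jn_triangle[OF J J J] by (simp add: add.assoc add.commute[of 1])
  also have "\<dots> \<le> real n * \<delta> + \<delta>" using Suc d by (intro add_mono) auto
  finally show ?case by (simp add: algebra_simps)
qed simp

section \<open>The subdivision scheme\<close>

context
  fixes N \<epsilon> :: real
  assumes N: "N \<ge> 1" and eps: "\<epsilon> > 0"
begin

text \<open>Consecutive averages share the set \<open>G (i + 1)\<close>, and each lies within
  \<delta> / 2 of it.\<close>

lemma smoothing_step:
  fixes G :: "int \<Rightarrow> 'a::euclidean_space set"
  assumes J: "\<And>i. G i \<in> Jn" and d: "\<And>i. dmu (G i) (G (i + 1)) \<le> \<delta>"
  defines "G' \<equiv> \<lambda>i. mavg N \<epsilon> (1/2) (G i) (G (i + 1))"
  shows "G' i \<in> Jn" "dmu (G' i) (G' (i + 1)) \<le> \<delta>" "dmu (G' i) (G i) \<le> \<delta>"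
proof -
  have G': "G' j \<in> Jn" "dmu (G j) (G' j) \<le> \<delta> / 2" "dmu (G' j) (G (j + 1)) \<le> \<delta> / 2" for j
    unfolding G'_def using mavg_between[OF J J _ _ N eps, of "1/2" j "j + 1"] d[of j] by auto
  show "G' i \<in> Jn" by (rule G')
  show "dmu (G' i) (G' (i + 1)) \<le> \<delta>"
    using dmu_Jn_triangle[OF G'(1)[of i] J[of "i + 1"] G'(1)[of "i + 1"]] G'(3)[of i] G'(2)[of "i + 1"] by simp
  show "dmu (G' i) (G i) \<le> \<delta>"
    using G'(2)[of i] dmu_nonneg[of "G i" "G' i"] unfolding dmu_commute[of "G' i"] by linarith
qed

lemma smoothing_steps:
  fixes G :: "int \<Rightarrow> 'a::euclidean_space set"
  assumes J: "\<And>i. G i \<in> Jn" and d: "\<And>i. dmu (G i) (G (i + 1)) \<le> \<delta>"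
  defines "H \<equiv> \<lambda>n. ((\<lambda>G i. mavg N \<epsilon> (1/2) (G i) (G (i + 1))) ^^ n) G"
  shows "H n i \<in> Jn" "dmu (H n i) (H n (i + 1)) \<le> \<delta>" "dmu (H n i) (G i) \<le> real n * \<delta>"
proof -
  have "(\<forall>i. H n i \<in> Jn) \<and> (\<forall>i. dmu (H n i) (H n (i + 1)) \<le> \<delta>) \<and> (\<forall>i. dmu (H n i) (G i) \<le> real n * \<delta>)"
  proof (induction n)
    case 0
    then show ?case using J d by (simp add: H_def)
  next
    case (Suc n)
    have S: "H n i \<in> Jn" "dmu (H n i) (H n (i + 1)) \<le> \<delta>" "dmu (H n i) (G i) \<le> real n * \<delta>" for i
      using Suc by blast+
    have "H (Suc n) = (\<lambda>i. mavg N \<epsilon> (1/2) (H n i) (H n (i + 1)))" by (simp add: H_def)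
    note * = smoothing_step[of "H n" \<delta>, OF S(1,2), folded fun_cong[OF this]]
    have "dmu (H (Suc n) i) (G i) \<le> real (Suc n) * \<delta>" for i
    proof -
      have "dmu (H (Suc n) i) (G i) \<le> dmu (H (Suc n) i) (H n i) + dmu (H n i) (G i)"
        by (intro dmu_Jn_triangle * S J)
      also have "\<dots> \<le> \<delta> + real n * \<delta>" by (intro add_mono * S)
      finally show ?thesis by (simp add: algebra_simps)
    qed
    then show ?case using * by blast
  qed
  then show "H n i \<in> Jn" "dmu (H n i) (H n (i + 1)) \<le> \<delta>" "dmu (H n i) (G i) \<le> real n * \<delta>" by auto
qed

text \<open>The hypothesis carries 2 \<delta> so that \<delta> is the halved spacing of the new
  level. The drift constant counts one \<delta> for inserting midpoints, at most m for the index
  shift \<open>s\<close> that centres the scheme, and at most m for the smoothing rounds.\<close>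

lemma spline_refine_bounds:
  fixes F :: "int \<Rightarrow> 'a::euclidean_space set"
  assumes J: "\<And>i. F i \<in> Jn" and d: "\<And>i. dmu (F i) (F (i + 1)) \<le> 2 * \<delta>"
  shows "spline_refine N \<epsilon> m F i \<in> Jn"
    "dmu (spline_refine N \<epsilon> m F i) (spline_refine N \<epsilon> m F (i + 1)) \<le> \<delta>"
    "dmu (F (i div 2)) (spline_refine N \<epsilon> m F i) \<le> (2 * real m + 1) * \<delta>"
proof -
  define G0 where "G0 i = (if even i then F (i div 2) else mavg N \<epsilon> (1/2) (F (i div 2)) (F (i div 2 + 1)))" for i
  define H where "H = ((\<lambda>G i. mavg N \<epsilon> (1/2) (G i) (G (i + 1))) ^^ (m - 1)) G0"
  define s where "s = int ((m - 1) div 2)"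
  have ref: "spline_refine N \<epsilon> m F i = H (i - s)" for i
    by (simp add: spline_refine_def Let_def H_def G0_def[abs_def] s_def)
  note half = mavg_between[OF J J _ _ N eps, of "1/2"]
  have J0: "G0 i \<in> Jn" for i using half J by (simp add: G0_def)
  have d0: "dmu (G0 i) (G0 (i + 1)) \<le> \<delta>" for i
  proof (cases "even i")
    case True
    then have "(i + 1) div 2 = i div 2" by (auto elim: evenE)
    then show ?thesis using True half(2)[of "i div 2" "i div 2 + 1"] d[of "i div 2"] by (simp add: G0_def)
  next
    case False
    then have "(i + 1) div 2 = i div 2 + 1" by (auto elim: oddE)
    then show ?thesis using False half(3)[of "i div 2" "i div 2 + 1"] d[of "i div 2"] by (simp add: G0_def)
  qed
  have FG: "dmu (F (i div 2)) (G0 i) \<le> \<delta>" for i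
    using half(2)[of "i div 2" "i div 2 + 1"] d[of "i div 2"] order_trans[OF dmu_nonneg d[of 0]]
    by (simp add: G0_def)
  note HH = smoothing_steps[of G0 \<delta> "m - 1", OF J0 d0, folded H_def]
  show "spline_refine N \<epsilon> m F i \<in> Jn" unfolding ref by (rule HH)
  show "dmu (spline_refine N \<epsilon> m F i) (spline_refine N \<epsilon> m F (i + 1)) \<le> \<delta>"
    unfolding ref using HH(2)[of "i - s"] by (simp add: algebra_simps)
  have \<delta>: "\<delta> \<ge> 0" using order_trans[OF dmu_nonneg d0[of 0]] .
  have "dmu (F (i div 2)) (H (i - s)) \<le> dmu (F (i div 2)) (G0 i) + dmu (G0 i) (H (i - s))"
    using J J0 HH(1) by (intro dmu_Jn_triangle)
  also have "dmu (G0 i) (H (i - s)) \<le> dmu (G0 i) (G0 (i - s)) + dmu (G0 (i - s)) (H (i - s))"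
    using J0 HH(1) by (intro dmu_Jn_triangle)
  also have "dmu (G0 i) (G0 (i - s)) \<le> real ((m - 1) div 2) * \<delta>"
    using dmu_chain[of G0 \<delta> "i - s" "(m - 1) div 2", OF J0 d0] by (simp add: dmu_commute s_def)
  also have "real ((m - 1) div 2) * \<delta> \<le> real m * \<delta>" using \<delta> by (intro mult_right_mono) auto
  also have "dmu (G0 (i - s)) (H (i - s)) \<le> real (m - 1) * \<delta>"
    using HH(3)[of "i - s"] by (simp add: dmu_commute)
  also have "real (m - 1) * \<delta> \<le> real m * \<delta>" using \<delta> by (intro mult_right_mono) auto
  also note FG[of i]
  finally show "dmu (F (i div 2)) (spline_refine N \<epsilon> m F i) \<le> (2 * real m + 1) * \<delta>"
    unfolding ref by (simp add: algebra_simps)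
qed

context
  fixes F0 :: "int \<Rightarrow> 'a::euclidean_space set" and m :: nat and L :: real
  assumes F0: "\<And>i. F0 i \<in> Jn" and L: "\<And>i. dmu (F0 i) (F0 (i + 1)) \<le> L"
begin

lemma spline_level_bounds:
  "spline_level N \<epsilon> m F0 k i \<in> Jn"
  "dmu (spline_level N \<epsilon> m F0 k i) (spline_level N \<epsilon> m F0 k (i + 1)) \<le> L / 2 ^ k"
proof -
  have "(\<forall>i. spline_level N \<epsilon> m F0 k i \<in> Jn) \<and>
    (\<forall>i. dmu (spline_level N \<epsilon> m F0 k i) (spline_level N \<epsilon> m F0 k (i + 1)) \<le> L / 2 ^ k)"
  proof (induction k)
    case 0
    then show ?case using F0 L by (simp add: spline_level_def)
  next
    case (Suc k)
    have "spline_level N \<epsilon> m F0 (Suc k) = spline_refine N \<epsilon> m (spline_level N \<epsilon> m F0 k)"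
      by (simp add: spline_level_def)
    then show ?case
      using Suc spline_refine_bounds(1,2)[of "spline_level N \<epsilon> m F0 k" "L / 2 ^ Suc k"] by simp
  qed
  then show "spline_level N \<epsilon> m F0 k i \<in> Jn"
  "dmu (spline_level N \<epsilon> m F0 k i) (spline_level N \<epsilon> m F0 k (i + 1)) \<le> L / 2 ^ k" by auto
qed

lemma spline_level_step:
  "dmu (spline_level N \<epsilon> m F0 k (i div 2)) (spline_level N \<epsilon> m F0 (Suc k) i) \<le> (2 * real m + 1) * (L / 2 ^ Suc k)"
proof -
  have d: "dmu (spline_level N \<epsilon> m F0 k i) (spline_level N \<epsilon> m F0 k (i + 1)) \<le> 2 * (L / 2 ^ Suc k)" for i
    using spline_level_bounds(2)[of k i] by simp
  have eq: "spline_level N \<epsilon> m F0 (Suc k) = spline_refine N \<epsilon> m (spline_level N \<epsilon> m F0 k)"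
    by (simp add: spline_level_def)
  show ?thesis unfolding eq by (rule spline_refine_bounds(3)[of "spline_level N \<epsilon> m F0 k", OF spline_level_bounds(1) d])
qed

lemma spline_interp_bounds:
  "spline_interp N \<epsilon> m F0 k x \<in> Jn"
  "dmu (spline_level N \<epsilon> m F0 k \<lfloor>x * 2 ^ k\<rfloor>) (spline_interp N \<epsilon> m F0 k x) \<le> L / 2 ^ k"
proof -
  define i where "i = \<lfloor>x * 2 ^ k\<rfloor>"
  define l where "l = real_of_int (i + 1) - x * 2 ^ k"
  have l: "0 \<le> l" "l \<le> 1" unfolding l_def i_def by linarith+
  have eq: "spline_interp N \<epsilon> m F0 k x = mavg N \<epsilon> l (spline_level N \<epsilon> m F0 k i) (spline_level N \<epsilon> m F0 k (i + 1))"
    by (simp add: spline_interp_def Let_def i_def l_def)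
  note * = mavg_between[OF spline_level_bounds(1) spline_level_bounds(1) l N eps, of k i k "i + 1"]
  show "spline_interp N \<epsilon> m F0 k x \<in> Jn" using * eq by simp
  have "(1 - l) * dmu (spline_level N \<epsilon> m F0 k i) (spline_level N \<epsilon> m F0 k (i + 1)) \<le> 1 * (L / 2 ^ k)"
    using l spline_level_bounds(2) dmu_nonneg by (intro mult_mono) auto
  then show "dmu (spline_level N \<epsilon> m F0 k \<lfloor>x * 2 ^ k\<rfloor>) (spline_interp N \<epsilon> m F0 k x) \<le> L / 2 ^ k"
    unfolding eq i_def[symmetric] *(2) by simp
qed

text \<open>The route goes through grid sets, as \<open>\<lfloor>x * 2 ^ k\<rfloor>\<close> is half
  the next level's index j, rounded down. In units of \<open>L / 2 ^ k\<close> the three legs cost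
  1, m + 1/2 and 1/2, in total m + 2.\<close>

lemma spline_interp_step:
  "dmu (spline_interp N \<epsilon> m F0 k x) (spline_interp N \<epsilon> m F0 (Suc k) x) \<le> (real m + 2) * L * (1/2) ^ k"
proof -
  let ?S = "spline_level N \<epsilon> m F0" and ?F = "spline_interp N \<epsilon> m F0"
  define j where "j = \<lfloor>x * 2 ^ Suc k\<rfloor>"
  have "\<lfloor>x * 2 ^ k\<rfloor> = j div 2"
  proof -
    have "x * 2 ^ k = (x * 2 ^ Suc k) / real_of_int 2" by simp
    then show ?thesis unfolding j_def by (metis floor_divide_real_eq_div zero_le_numeral)
  qed
  then have 1: "dmu (?F k x) (?S k (j div 2)) \<le> L / 2 ^ k"
    using spline_interp_bounds(2)[of k x] by (simp add: dmu_commute)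
  have 3: "dmu (?S (Suc k) j) (?F (Suc k) x) \<le> L / 2 ^ Suc k"
    using spline_interp_bounds(2)[of "Suc k" x] by (simp add: j_def)
  have "dmu (?F k x) (?F (Suc k) x) \<le> dmu (?F k x) (?S k (j div 2)) + dmu (?S k (j div 2)) (?F (Suc k) x)"
    by (intro dmu_Jn_triangle spline_interp_bounds spline_level_bounds)
  also have "dmu (?S k (j div 2)) (?F (Suc k) x) \<le> dmu (?S k (j div 2)) (?S (Suc k) j) + dmu (?S (Suc k) j) (?F (Suc k) x)"
    by (intro dmu_Jn_triangle spline_interp_bounds spline_level_bounds)
  also note 1
  also note 3
  also note spline_level_step[of k j]
  finally show ?thesis by (simp add: field_simps)
qed

text \<open>Of the three extra spacings \<open>L / 2 ^ k\<close>, two lead from the interpolants to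
  their grid sets; the third arises because the difference of the floors can exceed that of the
  scaled points by up to 1.\<close>

lemma spline_interp_lipschitz_approx:
  "dmu (spline_interp N \<epsilon> m F0 k x) (spline_interp N \<epsilon> m F0 k y) \<le> L * \<bar>x - y\<bar> + 3 * L * (1/2) ^ k"
proof -
  let ?S = "spline_level N \<epsilon> m F0" and ?F = "spline_interp N \<epsilon> m F0"
  have L0: "L \<ge> 0" using order_trans[OF dmu_nonneg L[of 0]] .
  have *: "dmu (?F k x) (?F k y) \<le> L * (y - x) + 3 * L * (1/2) ^ k" if "x \<le> y" for x y
  proof -
    define i j where "i = \<lfloor>x * 2 ^ k\<rfloor>" and "j = \<lfloor>y * 2 ^ k\<rfloor>"
    have ij: "i \<le> j" using that by (auto simp: i_def j_def intro!: floor_mono)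
    have "dmu (?S k i) (?S k j) \<le> real (nat (j - i)) * (L / 2 ^ k)"
      using dmu_chain[of "?S k" "L / 2 ^ k" i "nat (j - i)"] spline_level_bounds ij by simp
    also have "\<dots> \<le> ((y - x) * 2 ^ k + 1) * (L / 2 ^ k)"
    proof (rule mult_right_mono)
      have "real (nat (j - i)) = real_of_int (j - i)" using ij by simp
      also have "\<dots> \<le> y * 2 ^ k - (x * 2 ^ k - 1)" unfolding i_def j_def by linarith
      finally show "real (nat (j - i)) \<le> (y - x) * 2 ^ k + 1" by (simp add: algebra_simps)
    qed (use L0 in simp)
    also have "\<dots> = L * (y - x) + L / 2 ^ k" by (simp add: field_simps)
    finally have 2: "dmu (?S k i) (?S k j) \<le> L * (y - x) + L / 2 ^ k" .
    have 1: "dmu (?F k x) (?S k i) \<le> L / 2 ^ k" "dmu (?S k j) (?F k y) \<le> L / 2 ^ k"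
      using spline_interp_bounds(2)[of k] by (simp_all add: dmu_commute i_def j_def)
    have "dmu (?F k x) (?F k y) \<le> dmu (?F k x) (?S k i) + dmu (?S k i) (?F k y)"
      by (intro dmu_Jn_triangle spline_interp_bounds spline_level_bounds)
    also have "dmu (?S k i) (?F k y) \<le> dmu (?S k i) (?S k j) + dmu (?S k j) (?F k y)"
      by (intro dmu_Jn_triangle spline_interp_bounds spline_level_bounds)
    also note 1(1)
    also note 1(2)
    also note 2
    finally show ?thesis by (simp add: field_simps)
  qed
  show ?thesis
  proof (cases "x \<le> y")
    case True then show ?thesis using *[of x y] by simp
  next
    case False then show ?thesis using *[of y x] by (simp add: dmu_commute)
  qed
qed

end

end

section \<open>Passage to the limit\<close>

lemma limsup_set_approx:
  fixes X :: "nat \<Rightarrow> 'a::euclidean_space set"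
  assumes lm: "\<And>k. X k \<in> lmeasurable" and d: "\<And>k. dmu (X k) (X (Suc k)) \<le> c * (1/2) ^ k"
  defines "Z \<equiv> \<Inter>k. \<Union>j\<in>{k..}. X j"
  shows "Z \<in> lmeasurable" "dmu (X k) Z \<le> 2 * c * (1/2) ^ k"
proof -
  define E where "E j = (X j - X (Suc j)) \<union> (X (Suc j) - X j)" for j
  have E: "E j \<in> lmeasurable" for j unfolding E_def using lm by (intro fmeasurable.Un fmeasurable_Diff fmeasurableD)
  have mE: "measure lebesgue (E j) \<le> c * (1/2) ^ j" for j using d[of j] by (simp add: E_def dmu_def)
  have Zs: "Z \<in> sets lebesgue" unfolding Z_def using fmeasurableD[OF lm] by (intro sets.countable_INT'' sets.countable_UN') auto
  \<comment> \<open>A bound uniform over finite unions carries over to the countable union. The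
    factor 2 is the sum of the geometric series with ratio 1/2.\<close>
  have fin: "measure lebesgue (\<Union>j\<in>I. E (k + j)) \<le> 2 * c * (1/2) ^ k" if "finite I" for I k
  proof -
    have "(\<lambda>j. c * (1/2) ^ k * (1/2) ^ j) sums (c * (1/2) ^ k * (1 / (1 - 1/2)))"
      by (intro sums_mult geometric_sums) simp
    then have s: "(\<lambda>j. c * (1/2) ^ (k + j)) sums (2 * c * (1/2) ^ k)" by (simp add: power_add mult_ac)
    have "measure lebesgue (\<Union>j\<in>I. E (k + j)) \<le> (\<Sum>j\<in>I. measure lebesgue (E (k + j)))"
      using that E fmeasurableD by (intro measure_UNION_le) auto
    also have "\<dots> \<le> (\<Sum>j\<in>I. c * (1/2) ^ (k + j))" by (intro sum_mono mE)
    also have "\<dots> \<le> (\<Sum>j. c * (1/2) ^ (k + j))"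
      using that order_trans[OF measure_nonneg mE] s by (intro sum_le_suminf) (auto simp: sums_iff)
    also have "\<dots> = 2 * c * (1/2) ^ k" using s by (simp add: sums_iff)
    finally show ?thesis .
  qed
  have UE: "(\<Union>j. E (k + j)) \<in> lmeasurable" "measure lebesgue (\<Union>j. E (k + j)) \<le> 2 * c * (1/2) ^ k" for k
    by (rule fmeasurable_UN_bound[OF _ E fin] measure_UN_bound[OF _ E fin]; simp)+
  \<comment> \<open>If membership of p differs at k and k + n, it switches between two consecutive
    indices in that range.\<close>
  have stay: "p \<in> (\<Union>j. E (k + j))" if "(p \<in> X k) \<noteq> (p \<in> X (k + n))" for p k n
    using that
  proof (induction n)
    case (Suc n)
    show ?case
    proof (cases "(p \<in> X k) = (p \<in> X (k + n))")
      case True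
      then have "p \<in> E (k + n)" using Suc.prems by (auto simp: E_def)
      then show ?thesis by blast
    qed (rule Suc.IH)
  qed simp
  have sub: "(X k - Z) \<union> (Z - X k) \<subseteq> (\<Union>j. E (k + j))" for k
  proof
    fix p assume "p \<in> (X k - Z) \<union> (Z - X k)"
    then consider "p \<in> X k" "p \<notin> Z" | "p \<in> Z" "p \<notin> X k" by blast
    then show "p \<in> (\<Union>j. E (k + j))"
    proof cases
      case 1
      then obtain l where "\<And>j. j \<ge> l \<Longrightarrow> p \<notin> X j" by (auto simp: Z_def)
      then have "p \<notin> X (k + l)" by simp
      then show ?thesis using 1 stay[of p k l] by blast
    next
      case 2
      then obtain j where "j \<ge> k" "p \<in> X j" by (auto simp: Z_def)
      then show ?thesis using 2 stay[of p k "j - k"] by simp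
    qed
  qed
  have "Z \<subseteq> X 0 \<union> (\<Union>j. E (0 + j))" using sub[of 0] by blast
  then show "Z \<in> lmeasurable" using lm UE(1)[of 0] Zs by (meson fmeasurable.Un fmeasurableI2)
  then have "(X k - Z) \<union> (Z - X k) \<in> lmeasurable"
    using lm by (intro fmeasurable.Un fmeasurable_Diff fmeasurableD)
  then have "dmu (X k) Z \<le> measure lebesgue (\<Union>j. E (k + j))"
    unfolding dmu_def using sub UE by (intro measure_mono_fmeasurable fmeasurableD)
  then show "dmu (X k) Z \<le> 2 * c * (1/2) ^ k" using UE(2)[of k] by linarith
qed

theorem mainTheorem10:
  fixes F0 :: "int \<Rightarrow> 'a::euclidean_space set"
    and m :: nat and N \<epsilon> L :: real
  assumes "m \<ge> 1"
    and "N \<ge> 1" and "\<epsilon> > 0"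
    and "\<forall>i. F0 i \<in> Jn"
    and "bdd_above (range (\<lambda>i. dmu (F0 i) (F0 (i + 1))))"
    and "L = (SUP i. dmu (F0 i) (F0 (i + 1)))"
  shows "\<exists>Finf :: real \<Rightarrow> 'a set.
           (\<forall>k x. spline_interp N \<epsilon> m F0 k x \<in> sets lebesgue
                  \<and> emeasure lebesgue (spline_interp N \<epsilon> m F0 k x) < \<infinity>)
         \<and> (\<forall>x. Finf x \<in> sets lebesgue \<and> emeasure lebesgue (Finf x) < \<infinity>)
         \<and> (\<forall>e>0. \<exists>K. \<forall>k\<ge>K. \<forall>x. dmu (spline_interp N \<epsilon> m F0 k x) (Finf x) < e)
         \<and> (\<forall>x y. dmu (Finf x) (Finf y) \<le> L * \<bar>x - y\<bar>)"
proof -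
  define F where "F = spline_interp N \<epsilon> m F0"
  have J: "F0 i \<in> Jn" for i using assms(4) by blast
  have dL: "dmu (F0 i) (F0 (i + 1)) \<le> L" for i
    unfolding assms(6) by (intro cSUP_upper assms(5)) simp
  have lmF: "F k x \<in> lmeasurable" for k x
    unfolding F_def by (rule JnD(4)[OF spline_interp_bounds(1)[of N \<epsilon> F0, OF assms(2,3) J dL]])
  define c where "c = (real m + 2) * L"
  have step: "dmu (F k x) (F (Suc k) x) \<le> c * (1/2) ^ k" for k x
    unfolding F_def c_def by (rule spline_interp_step[of N \<epsilon> F0, OF assms(2,3) J dL])
  have lip: "dmu (F k x) (F k y) \<le> L * \<bar>x - y\<bar> + 3 * L * (1/2) ^ k" for k x y
    unfolding F_def by (rule spline_interp_lipschitz_approx[of N \<epsilon> F0, OF assms(2,3) J dL])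
  define Finf where "Finf x = (\<Inter>k. \<Union>j\<in>{k..}. F j x)" for x
  have lmI: "Finf x \<in> lmeasurable" for x
    unfolding Finf_def by (rule limsup_set_approx(1)[of "\<lambda>k. F k x", OF lmF step])
  have conv: "dmu (F k x) (Finf x) \<le> 2 * c * (1/2) ^ k" for k x
    unfolding Finf_def by (rule limsup_set_approx(2)[of "\<lambda>k. F k x", OF lmF step])
  have lim0: "(\<lambda>k. C * (1/2) ^ k) \<longlonglongrightarrow> 0" for C :: real
    using tendsto_mult[OF tendsto_const[of C] LIMSEQ_realpow_zero[of "1/2 :: real"]] by simp
  have fin: "X \<in> sets lebesgue \<and> emeasure lebesgue X < \<infinity>" if "X \<in> lmeasurable" for X :: "'a set"
    using that unfolding fmeasurable_def by (simp only: mem_Collect_eq infinity_ennreal_def)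
  have "\<exists>K. \<forall>k\<ge>K. \<forall>x. dmu (F k x) (Finf x) < e" if "e > 0" for e
  proof -
    have "eventually (\<lambda>k. 2 * c * (1/2) ^ k < e) sequentially"
      using order_tendstoD(2)[OF lim0 that] .
    then obtain K where "\<And>k. k \<ge> K \<Longrightarrow> 2 * c * (1/2) ^ k < e" by (auto simp: eventually_sequentially)
    then show ?thesis using conv order_le_less_trans by blast
  qed
  moreover have "dmu (Finf x) (Finf y) \<le> L * \<bar>x - y\<bar>" for x y
  proof (rule LIMSEQ_le_const)
    \<comment> \<open>x and y each contribute \<open>2 * c\<close> for passing between the limit and
      level k; the estimate on level k itself contributes \<open>3 * L\<close>.\<close>
    have "(\<lambda>k. L * \<bar>x - y\<bar> + (4 * c + 3 * L) * (1/2) ^ k) \<longlonglongrightarrow> L * \<bar>x - y\<bar> + 0"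
      by (intro tendsto_add tendsto_const lim0)
    then show "(\<lambda>k. L * \<bar>x - y\<bar> + (4 * c + 3 * L) * (1/2) ^ k) \<longlonglongrightarrow> L * \<bar>x - y\<bar>" by simp
    have "dmu (Finf x) (Finf y) \<le> L * \<bar>x - y\<bar> + (4 * c + 3 * L) * (1/2) ^ k" for k
    proof -
      have "dmu (Finf x) (Finf y) \<le> dmu (Finf x) (F k x) + dmu (F k x) (Finf y)"
        by (intro dmu_triangle lmF lmI)
      also have "dmu (F k x) (Finf y) \<le> dmu (F k x) (F k y) + dmu (F k y) (Finf y)"
        by (intro dmu_triangle lmF lmI)
      also have "dmu (Finf x) (F k x) \<le> 2 * c * (1/2) ^ k" using conv by (simp add: dmu_commute)
      also note lip[of k x y]
      also note conv[of k y]
      finally show ?thesis by (simp add: algebra_simps)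
    qed
    then show "\<exists>K. \<forall>k\<ge>K. dmu (Finf x) (Finf y) \<le> L * \<bar>x - y\<bar> + (4 * c + 3 * L) * (1/2) ^ k" by blast
  qed
  ultimately show ?thesis
    unfolding F_def[symmetric] using fin lmF lmI by (intro exI[of _ Finf]) blast
qed

end
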